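(* Let $\mathcal{A}=\bigsqcup_{n\ge 1}\mathcal{A}_n$ be a disjoint union of sets of matrices $\mathcal{A}_n\subseteq\mathcal{S}^n$ such that for each $n\ge 5$: (I) If $A\in\mathcal{A}_n$, then there is a row $i$ such that either all off-diagonal entries in row $i$ are nonnegative, or all off-diagonal entries in row $i$ are nonpositive and at least one is nonzero. (II) If $A\in\mathcal{A}_n$ and row $i$ of $A$ has all nonnegative off-diagonal entries, then $A(i)\in\mathcal{A}_{n-1}$. (III) If $A\in\mathcal{A}_n$ has no rows with all nonnegative entries, then there is a row $i$ with all nonpositive off-diagonal entries and a nonzero diagonal entry $a_{i,i}$ such that the Schur complement $A/a_{i,i}$ belongs to $\mathcal{A}_{n-1}$. If $A\in\mathcal{A}$ is copositive, then $A$ admits an SPN decomposition.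
   Context: $\mathcal{S}^n$ is the set of real symmetric $n\times n$ matrices. A matrix $A\in\mathcal{S}^n$ is copositive if $x^\top A x\ge 0$ for all entrywise nonnegative $x\in\mathbb{R}^n$. $A$ admits an SPN decomposition if $A=P+N$ with $P$ symmetric positive semidefinite and $N$ symmetric with nonnegative entries. $A(i)$ denotes the $(n-1)\times(n-1)$ submatrix of $A$ obtained by deleting row $i$ and column $i$. For $a_{i,i}\neq 0$, the Schur complement is $A/a_{i,i}=A(i)-\frac{1}{a_{i,i}}uu^\top$, where $u\in\mathbb{R}^{n-1}$ is the $i$-th column of $A$ with its $i$-th entry removed. *)

theory Defs
  imports Complex_Main "Jordan_Normal_Form.Determinant"
begin

text \<open>The order on vectors and matrices from \<^theory>\<open>Jordan_Normal_Form.Matrix\<close> is the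
  entrywise one. Rows and columns are numbered from 0.\<close>

definition sym_mats :: "nat \<Rightarrow> real mat set" where
  "sym_mats n = {A \<in> carrier_mat n n. A\<^sup>T = A}"

definition copositive :: "real mat \<Rightarrow> bool" where
  "copositive A \<longleftrightarrow> A \<in> sym_mats (dim_row A) \<and>
     (\<forall>x \<in> carrier_vec (dim_row A). 0\<^sub>v (dim_row A) \<le> x \<longrightarrow> 0 \<le> x \<bullet> (A *\<^sub>v x))"

definition pos_semidef :: "real mat \<Rightarrow> bool" where
  "pos_semidef A \<longleftrightarrow> A \<in> sym_mats (dim_row A) \<and>
     (\<forall>x \<in> carrier_vec (dim_row A). 0 \<le> x \<bullet> (A *\<^sub>v x))"

definition has_spn_decomposition :: "real mat \<Rightarrow> bool" where
  "has_spn_decomposition A \<longleftrightarrow>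
     (\<exists>P \<in> sym_mats (dim_row A). \<exists>N \<in> sym_mats (dim_row A).
        A = P + N \<and> pos_semidef P \<and> 0\<^sub>m (dim_row A) (dim_row A) \<le> N)"

definition offdiag_nonneg :: "real mat \<Rightarrow> nat \<Rightarrow> bool" where
  "offdiag_nonneg A i \<longleftrightarrow> (\<forall>j < dim_col A. j \<noteq> i \<longrightarrow> 0 \<le> A $$ (i, j))"

definition offdiag_nonpos :: "real mat \<Rightarrow> nat \<Rightarrow> bool" where
  "offdiag_nonpos A i \<longleftrightarrow> (\<forall>j < dim_col A. j \<noteq> i \<longrightarrow> A $$ (i, j) \<le> 0)"

text \<open>\<^const>\<open>insert_index\<close>\<open> i\<close> enumerates the indices different from \<open>i\<close> in increasing order,
  matching \<^const>\<open>mat_delete\<close>.\<close>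

definition col_delete :: "real mat \<Rightarrow> nat \<Rightarrow> real vec" where
  "col_delete A i = vec (dim_row A - 1) (\<lambda>j. A $$ (insert_index i j, i))"

definition outer_prod :: "real vec \<Rightarrow> real vec \<Rightarrow> real mat" where
  "outer_prod u v = mat (dim_vec u) (dim_vec v) (\<lambda>(j, k). u $ j * v $ k)"

definition schur_complement :: "real mat \<Rightarrow> nat \<Rightarrow> real mat" where
  "schur_complement A i =
     mat_delete A i i - (1 / A $$ (i, i)) \<cdot>\<^sub>m outer_prod (col_delete A i) (col_delete A i)"

end

theory Submission
  imports Defs
begin

text \<open>Two reductions lower the order of a copositive matrix \<open>A\<close>. If row \<open>i\<close> is nonnegative off the
  diagonal, then an SPN decomposition of \<open>A(i)\<close> extends to \<open>A\<close>, with row and column \<open>i\<close> going into the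
  nonnegative part. If row \<open>i\<close> is nonpositive off the diagonal and \<open>a\<^sub>i\<^sub>i > 0\<close>, then the Schur complement is
  again copositive, and completing the square turns a decomposition of it into one of \<open>A\<close>
  (\<open>spn_on_nonneg_row\<close>, \<open>copositive_on_schur\<close>, \<open>spn_on_schur\<close>). The hypotheses on the class make these
  reductions available, within the class, for all orders from 5 on. This leaves the theorem of
  Diananda that every copositive matrix of order at most 4 has an SPN decomposition.

  Up to order 3 some row has off-diagonal entries of one sign, so the reductions suffice. In order 4 they
  fail only if every row has mixed signs; then, up to relabelling, \<open>a\<^sub>1\<^sub>2, a\<^sub>3\<^sub>4 < 0 \<le> a\<^sub>1\<^sub>3, a\<^sub>2\<^sub>4\<close>. The relevant
  entries are written as \<open>- d\<^sub>i d\<^sub>j cos \<theta>\<^sub>i\<^sub>j\<close> with \<open>d\<^sub>i\<^sup>2 = a\<^sub>i\<^sub>i\<close>. Two kinds of explicit semidefinite matrices below \<open>A\<close>, a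
  Gram matrix of four vectors in the plane (\<open>spn_on_planar\<close>) and a tridiagonal matrix
  (\<open>spn_on_tridiagonal\<close>), leave only the case in which the angles along a 4-cycle are the sides of a
  spherical quadrilateral (\<open>spn_on_polygon\<close>). There \<open>spn_on_pivot\<close> lowers the entry \<open>a\<^sub>1\<^sub>3\<close> so that the Schur
  complement of \<open>a\<^sub>1\<^sub>1\<close> becomes copositive of order 3, hence decomposable.\<close>

section \<open>Quadratic forms and copositivity on a finite index set\<close>

text \<open>A matrix is taken here as a function of two indices, of which only the values on a finite index
  set \<open>S\<close> matter. Deleting a row and a column is then the passage to a subset of \<open>S\<close>, and no
  renumbering is needed. This is the quadratic form \<open>x\<^sup>T a x\<close> of the matrix \<open>a\<close> on \<open>S\<close>.\<close>

definition quad_form :: "'a set \<Rightarrow> ('a \<Rightarrow> 'a \<Rightarrow> real) \<Rightarrow> ('a \<Rightarrow> real) \<Rightarrow> real" where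
  "quad_form S a x = (\<Sum>i\<in>S. \<Sum>j\<in>S. a i j * x i * x j)"

text \<open>Symmetry of the matrix on the index set \<open>S\<close>.\<close>

definition symmetric_on :: "'a set \<Rightarrow> ('a \<Rightarrow> 'a \<Rightarrow> real) \<Rightarrow> bool" where
  "symmetric_on S a \<longleftrightarrow> (\<forall>i\<in>S. \<forall>j\<in>S. a i j = a j i)"

text \<open>Copositivity on \<open>S\<close>; symmetry is a separate hypothesis throughout.\<close>

definition copositive_on :: "'a set \<Rightarrow> ('a \<Rightarrow> 'a \<Rightarrow> real) \<Rightarrow> bool" where
  "copositive_on S a \<longleftrightarrow> (\<forall>x. (\<forall>i\<in>S. 0 \<le> x i) \<longrightarrow> 0 \<le> quad_form S a x)"

text \<open>Existence of an SPN decomposition on \<open>S\<close>. Only the positive semidefinite part \<open>p\<close> is named: for a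
  symmetric matrix \<open>a\<close>, the nonnegative part is \<open>a - p\<close>, so that the condition on it is \<open>p \<le> a\<close> entrywise.\<close>

definition spn_on :: "'a set \<Rightarrow> ('a \<Rightarrow> 'a \<Rightarrow> real) \<Rightarrow> bool" where
  "spn_on S a \<longleftrightarrow>
     (\<exists>p. symmetric_on S p \<and> (\<forall>i\<in>S. \<forall>j\<in>S. p i j \<le> a i j) \<and> (\<forall>x. 0 \<le> quad_form S p x))"

text \<open>The Schur complement of the diagonal entry \<open>a k k\<close>, to be read on an index set without \<open>k\<close>.
  Using column \<open>k\<close> for one factor and row \<open>k\<close> for the other makes no difference when \<open>a\<close> is symmetric.\<close>

definition schur_on :: "'a \<Rightarrow> ('a \<Rightarrow> 'a \<Rightarrow> real) \<Rightarrow> 'a \<Rightarrow> 'a \<Rightarrow> real" where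
  "schur_on k a i j = a i j - a i k * a k j / a k k"

lemma symmetric_onD: "symmetric_on S a \<Longrightarrow> i \<in> S \<Longrightarrow> j \<in> S \<Longrightarrow> a i j = a j i"
  by (auto simp: symmetric_on_def)

lemma symmetric_on_mono: "symmetric_on S a \<Longrightarrow> T \<subseteq> S \<Longrightarrow> symmetric_on T a"
  by (auto simp: symmetric_on_def)

lemma quad_form_cong:
  assumes "\<And>i j. i \<in> S \<Longrightarrow> j \<in> S \<Longrightarrow> a i j = b i j" "\<And>i. i \<in> S \<Longrightarrow> x i = y i"
  shows "quad_form S a x = quad_form S b y"
  unfolding quad_form_def by (intro sum.cong refl) (simp add: assms)

lemma quad_form_remove:
  assumes "finite S" "k \<in> S" "symmetric_on S a"
  shows "quad_form S a x =
    a k k * (x k)\<^sup>2 + 2 * x k * (\<Sum>j\<in>S - {k}. a k j * x j) + quad_form (S - {k}) a x"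
proof -
  have inner: "(\<Sum>j\<in>S. a i j * x i * x j) = a i k * x i * x k + (\<Sum>j\<in>S-{k}. a i j * x i * x j)" for i
    by (rule sum.remove) (use assms in auto)
  have "quad_form S a x = (\<Sum>j\<in>S. a k j * x k * x j) + (\<Sum>i\<in>S-{k}. \<Sum>j\<in>S. a i j * x i * x j)"
    unfolding quad_form_def by (rule sum.remove) (use assms in auto)
  also have "(\<Sum>i\<in>S-{k}. \<Sum>j\<in>S. a i j * x i * x j)
      = (\<Sum>i\<in>S-{k}. a i k * x i * x k) + quad_form (S - {k}) a x"
    unfolding inner quad_form_def by (simp add: sum.distrib)
  also have "(\<Sum>i\<in>S-{k}. a i k * x i * x k) = x k * (\<Sum>j\<in>S - {k}. a k j * x j)"
    unfolding sum_distrib_left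
    by (intro sum.cong refl) (use assms in \<open>auto simp: symmetric_on_def\<close>)
  also have "(\<Sum>j\<in>S. a k j * x k * x j) = a k k * (x k)\<^sup>2 + x k * (\<Sum>j\<in>S - {k}. a k j * x j)"
    unfolding inner sum_distrib_left by (simp add: power2_eq_square mult_ac)
  finally show ?thesis by simp
qed

text \<open>Completing the square in the variable \<open>x k\<close>.\<close>

lemma quad_form_schur:
  assumes "finite S" "k \<in> S" "symmetric_on S a" "a k k \<noteq> 0"
  shows "quad_form S a x =
    a k k * (x k + (\<Sum>j\<in>S - {k}. a k j * x j) / a k k)\<^sup>2 + quad_form (S - {k}) (schur_on k a) x"
proof -
  define l where "l = (\<Sum>j\<in>S - {k}. a k j * x j)"
  have "quad_form (S - {k}) (schur_on k a) x
      = (\<Sum>i\<in>S-{k}. \<Sum>j\<in>S-{k}. a i j * x i * x j - (a k i * x i) * (a k j * x j) / a k k)"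
    unfolding quad_form_def schur_on_def
    by (intro sum.cong refl) (use assms in \<open>auto simp: symmetric_on_def algebra_simps\<close>)
  also have "\<dots> = quad_form (S - {k}) a x - l * l / a k k"
    unfolding quad_form_def l_def sum_product sum_subtractf sum_divide_distrib by simp
  finally have "quad_form (S - {k}) (schur_on k a) x = quad_form (S - {k}) a x - l * l / a k k" .
  moreover have "a k k * (x k + l / a k k)\<^sup>2 = a k k * (x k)\<^sup>2 + 2 * x k * l + l * l / a k k"
    using assms(4) by (simp add: field_simps power2_eq_square)
  ultimately show ?thesis
    unfolding quad_form_remove[OF assms(1-3)] l_def[symmetric] by simp
qed

lemma copositive_onD: "copositive_on S a \<Longrightarrow> (\<And>i. i \<in> S \<Longrightarrow> 0 \<le> x i) \<Longrightarrow> 0 \<le> quad_form S a x"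
  by (auto simp: copositive_on_def)

lemma copositive_on_subset:
  assumes "finite S" "copositive_on S a" "T \<subseteq> S"
  shows "copositive_on T a"
  unfolding copositive_on_def
proof (intro allI impI)
  fix x :: "'a \<Rightarrow> real" assume x: "\<forall>i\<in>T. 0 \<le> x i"
  define y where "y i = (if i \<in> T then x i else 0)" for i
  have "quad_form S a y = quad_form T a y"
  proof -
    have "(\<Sum>j\<in>S. a i j * y i * y j) = (\<Sum>j\<in>T. a i j * y i * y j)" for i
      by (rule sum.mono_neutral_right) (use assms in \<open>auto simp: y_def\<close>)
    moreover have "(\<Sum>i\<in>S. \<Sum>j\<in>T. a i j * y i * y j) = (\<Sum>i\<in>T. \<Sum>j\<in>T. a i j * y i * y j)"
      by (rule sum.mono_neutral_right) (use assms in \<open>auto simp: y_def\<close>)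
    ultimately show ?thesis unfolding quad_form_def by simp
  qed
  also have "\<dots> = quad_form T a x"
    by (rule quad_form_cong) (auto simp: y_def)
  finally show "0 \<le> quad_form T a x"
    using copositive_onD[OF assms(2), of y] x by (auto simp: y_def)
qed

lemma copositive_on_diag_nonneg:
  assumes "finite S" "copositive_on S a" "k \<in> S"
  shows "0 \<le> a k k"
  using copositive_onD[OF copositive_on_subset[OF assms(1,2), of "{k}"], of "\<lambda>_. 1"] assms(3)
  by (auto simp: quad_form_def)

lemma copositive_on_offdiag_nonneg:
  assumes "finite S" "symmetric_on S a" "copositive_on S a" "k \<in> S" "j \<in> S" "a k k = 0"
  shows "0 \<le> a k j"
proof (cases "j = k")
  case False
  show ?thesis
  proof (rule ccontr)
    assume neg: "\<not> 0 \<le> a k j"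
    \<comment> \<open>With \<open>a k k = 0\<close> the form at \<open>(t, 1)\<close> is \<open>2 t a k j + a j j\<close>; this \<open>t\<close> makes it \<open>-1\<close>.\<close>
    define t where "t = (a j j + 1) / (- 2 * a k j)"
    have "0 \<le> a j j" using copositive_on_diag_nonneg assms by metis
    hence t: "0 \<le> t" using neg unfolding t_def by (intro divide_nonneg_nonneg) auto
    have "0 \<le> quad_form {k, j} a (\<lambda>i. if i = k then t else 1)"
      by (rule copositive_onD[OF copositive_on_subset[OF assms(1,3)]]) (use assms t in auto)
    also have "\<dots> = 2 * t * a k j + a j j"
      using False assms symmetric_onD[OF assms(2,4,5)] by (simp add: quad_form_def)
    also have "\<dots> = -1" using neg by (simp add: t_def field_simps)
    finally show False by simp
  qed
qed (use assms in simp)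

lemma spn_on_mono:
  assumes "spn_on S b" "\<And>i j. i \<in> S \<Longrightarrow> j \<in> S \<Longrightarrow> b i j \<le> a i j"
  shows "spn_on S a"
  using assms unfolding spn_on_def by (meson order_trans)

section \<open>Reduction by a row of constant sign\<close>

lemma spn_on_nonneg_row:
  assumes "finite S" "symmetric_on S a" "copositive_on S a" "k \<in> S"
    and "\<And>j. j \<in> S \<Longrightarrow> j \<noteq> k \<Longrightarrow> 0 \<le> a k j"
    and "spn_on (S - {k}) a"
  shows "spn_on S a"
proof -
  obtain p where p: "symmetric_on (S - {k}) p" "\<forall>i\<in>S - {k}. \<forall>j\<in>S - {k}. p i j \<le> a i j"
    "\<And>x. 0 \<le> quad_form (S - {k}) p x"
    using assms(6) by (auto simp: spn_on_def)
  define p' where "p' i j = (if i = k \<or> j = k then 0 else p i j)" for i j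
  have sym: "symmetric_on S p'" using p(1) by (auto simp: symmetric_on_def p'_def)
  have row: "0 \<le> a k j" if "j \<in> S" for j
    using assms(5)[of j] copositive_on_diag_nonneg[OF assms(1,3,4)] that by (cases "j = k") auto
  have "p' i j \<le> a i j" if "i \<in> S" "j \<in> S" for i j
    using p(2)[rule_format, of i j] row[of i] row[of j] that symmetric_onD[OF assms(2), of i k] assms(4)
    by (auto simp: p'_def)
  moreover have "0 \<le> quad_form S p' x" for x
  proof -
    have "quad_form (S - {k}) p' x = quad_form (S - {k}) p x"
      by (rule quad_form_cong) (auto simp: p'_def)
    moreover have "(\<Sum>j\<in>S - {k}. p' k j * x j) = 0" by (simp add: p'_def)
    ultimately show ?thesis
      using p(3)[of x] by (simp add: quad_form_remove[OF assms(1,4) sym]) (simp add: p'_def)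
  qed
  ultimately show ?thesis unfolding spn_on_def using sym by blast
qed

lemma spn_on_schur:
  assumes "finite S" "symmetric_on S a" "k \<in> S" "0 < a k k" "spn_on (S - {k}) (schur_on k a)"
  shows "spn_on S a"
proof -
  obtain p where p: "symmetric_on (S - {k}) p"
    "\<forall>i\<in>S - {k}. \<forall>j\<in>S - {k}. p i j \<le> schur_on k a i j"
    "\<And>x. 0 \<le> quad_form (S - {k}) p x"
    using assms(5) by (auto simp: spn_on_def)
  define p' where "p' i j = (if i = k \<or> j = k then a i j else p i j + a i k * a k j / a k k)" for i j
  have sym: "symmetric_on S p'"
    using p(1) assms(2,3) by (auto simp: symmetric_on_def p'_def)
  have "p' i j \<le> a i j" if "i \<in> S" "j \<in> S" for i j
    using p(2)[rule_format, of i j] that by (auto simp: p'_def schur_on_def)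
  moreover have "0 \<le> quad_form S p' x" for x
  proof -
    have kk: "p' k k = a k k" by (simp add: p'_def)
    have "quad_form (S - {k}) (schur_on k p') x = quad_form (S - {k}) p x"
      by (rule quad_form_cong) (auto simp: p'_def schur_on_def)
    thus ?thesis
      using p(3)[of x] assms(4) quad_form_schur[OF assms(1,3) sym, of x] unfolding kk by simp
  qed
  ultimately show ?thesis unfolding spn_on_def using sym by blast
qed

text \<open>When row \<open>k\<close> is nonpositive off the diagonal, the value of \<open>x k\<close> that makes the square vanish in
  \<open>quad_form_schur\<close> is nonnegative for every nonnegative choice of the other variables.\<close>

lemma copositive_on_schur:
  assumes "finite S" "symmetric_on S a" "copositive_on S a" "k \<in> S" "0 < a k k"
    and "\<And>j. j \<in> S \<Longrightarrow> j \<noteq> k \<Longrightarrow> a k j \<le> 0"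
  shows "copositive_on (S - {k}) (schur_on k a)"
  unfolding copositive_on_def
proof (intro allI impI)
  fix x :: "'a \<Rightarrow> real" assume x: "\<forall>i\<in>S - {k}. 0 \<le> x i"
  define l where "l = (\<Sum>j\<in>S - {k}. a k j * x j)"
  define y where "y = x(k := - l / a k k)"
  have ly: "(\<Sum>j\<in>S - {k}. a k j * y j) = l"
    unfolding l_def by (rule sum.cong) (auto simp: y_def)
  have "l \<le> 0" unfolding l_def using x assms(6) by (intro sum_nonpos) (auto intro: mult_nonpos_nonneg)
  hence "0 \<le> quad_form S a y"
    using x assms(5) by (intro copositive_onD[OF assms(3)]) (auto simp: y_def divide_nonpos_pos)
  also have "\<dots> = quad_form (S - {k}) (schur_on k a) y"
    using assms(5) by (subst quad_form_schur[OF assms(1,4,2)]) (auto simp: ly, simp add: y_def)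
  also have "\<dots> = quad_form (S - {k}) (schur_on k a) x"
    by (rule quad_form_cong) (auto simp: y_def)
  finally show "0 \<le> quad_form (S - {k}) (schur_on k a) x" .
qed

lemma symmetric_on_schur:
  assumes "symmetric_on S a" "k \<in> S"
  shows "symmetric_on S (schur_on k a)"
  using assms by (auto simp: symmetric_on_def schur_on_def)

lemma spn_on_same_sign_row:
  assumes "finite S" "symmetric_on S a" "copositive_on S a" "k \<in> S"
    and "(\<forall>j\<in>S - {k}. 0 \<le> a k j) \<or> (\<forall>j\<in>S - {k}. a k j \<le> 0)"
    and smaller: "\<And>b. symmetric_on (S - {k}) b \<Longrightarrow> copositive_on (S - {k}) b \<Longrightarrow> spn_on (S - {k}) b"
  shows "spn_on S a"
proof (cases "\<forall>j\<in>S - {k}. 0 \<le> a k j")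
  case True
  have "spn_on (S - {k}) a"
    using symmetric_on_mono[OF assms(2)] copositive_on_subset[OF assms(1,3)] by (intro smaller) auto
  with True show ?thesis by (intro spn_on_nonneg_row[OF assms(1-4)]) auto
next
  case False
  hence nonpos: "\<And>j. j \<in> S \<Longrightarrow> j \<noteq> k \<Longrightarrow> a k j \<le> 0" using assms(5) by auto
  \<comment> \<open>A zero diagonal entry would force the whole row to be nonnegative.\<close>
  have "a k k \<noteq> 0" using False copositive_on_offdiag_nonneg[OF assms(1-4)] by auto
  hence pos: "0 < a k k" using copositive_on_diag_nonneg[OF assms(1,3,4)] by simp
  show ?thesis
    using copositive_on_schur[OF assms(1-4) pos nonpos] symmetric_on_mono[OF symmetric_on_schur[OF assms(2,4)]]
    by (intro spn_on_schur[of S a k, OF assms(1,2,4) pos] smaller) auto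
qed

text \<open>Up to order 3 there is always a row whose off-diagonal entries have the same sign: if all
  three rows had mixed signs, the edges of a triangle would carry two signs that alternate around it.\<close>

lemma spn_on_card_le_3:
  assumes "finite S" "card S \<le> 3" "symmetric_on S a" "copositive_on S a"
  shows "spn_on S a"
  using assms
proof (induction "card S" arbitrary: S a rule: less_induct)
  case less
  show ?case
  proof (cases "S = {}")
    case True
    thus ?thesis by (auto simp: spn_on_def symmetric_on_def quad_form_def)
  next
    case False
    have "\<exists>k\<in>S. (\<forall>j\<in>S - {k}. 0 \<le> a k j) \<or> (\<forall>j\<in>S - {k}. a k j \<le> 0)"
    proof -
      have "card S \<noteq> 0" using less False by auto
      hence "card S = 1 \<or> card S = 2 \<or> card S = 3" using less by linarith
      moreover have ?thesis if "card S = 1"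
        using that by (auto simp: card_1_singleton_iff)
      moreover have ?thesis if "card S = 2"
      proof -
        from that obtain i j where S: "S = {i, j}" "i \<noteq> j" by (auto simp: card_2_iff)
        thus ?thesis using linear[of "a i j" 0] by auto
      qed
      moreover have ?thesis if "card S = 3"
      proof -
        from that obtain i j k where S: "S = {i, j, k}" "i \<noteq> j" "j \<noteq> k" "i \<noteq> k" by (auto simp: card_3_iff)
        have sym: "a j i = a i j" "a k i = a i k" "a k j = a j k"
          using S(1) by (auto intro: symmetric_onD[OF less.prems(3)])
        have rest: "S - {i} = {j, k}" "S - {j} = {i, k}" "S - {k} = {i, j}" using S by auto
        have "\<exists>v\<in>{i, j, k}. (\<forall>w\<in>S - {v}. 0 \<le> a v w) \<or> (\<forall>w\<in>S - {v}. a v w \<le> 0)"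
          unfolding bex_simps ball_simps rest sym
          using linear[of "a i j" 0] linear[of "a i k" 0] linear[of "a j k" 0] by blast
        thus ?thesis by (simp only: S(1))
      qed
      ultimately show ?thesis by blast
    qed
    then obtain k where k: "k \<in> S" "(\<forall>j\<in>S - {k}. 0 \<le> a k j) \<or> (\<forall>j\<in>S - {k}. a k j \<le> 0)" by blast
    have c: "card (S - {k}) < card S" using k(1) less.prems(1) by (meson card_Diff1_less)
    show ?thesis
      by (rule spn_on_same_sign_row[OF less.prems(1,3,4) k])
        (use less.hyps[OF c] less.prems c in auto)
  qed
qed

section \<open>Lowering an entry before a pivot in order 4\<close>

lemma quad_form_3:
  assumes "distinct [i, j, k]" "symmetric_on {i, j, k} a"
  shows "quad_form {i, j, k} a x =
    a i i * (x i)\<^sup>2 + a j j * (x j)\<^sup>2 + a k k * (x k)\<^sup>2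
    + 2 * a i j * x i * x j + 2 * a i k * x i * x k + 2 * a j k * x j * x k"
proof -
  have "a j i = a i j" "a k i = a i k" "a k j = a j k"
    by (auto intro: symmetric_onD[OF assms(2)])
  thus ?thesis using assms(1) by (simp add: quad_form_def power2_eq_square)
qed

lemma quad_form_4:
  assumes "distinct [i, j, k, l]" "symmetric_on {i, j, k, l} a"
  shows "quad_form {i, j, k, l} a x =
    a i i * (x i)\<^sup>2 + 2 * x i * (a i j * x j + a i k * x k + a i l * x l)
    + quad_form {j, k, l} a x"
proof -
  have "{i, j, k, l} - {i} = {j, k, l}" using assms(1) by auto
  thus ?thesis
    using assms(1) by (subst quad_form_remove[of _ i, OF _ _ assms(2)]) auto
qed

lemma psd_cauchy_schwarz:
  fixes A B C :: real
  assumes "\<And>t. 0 \<le> A + 2 * t * B + t\<^sup>2 * C" "0 \<le> C"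
  shows "\<bar>B\<bar> \<le> sqrt A * sqrt C"
proof -
  have "B\<^sup>2 \<le> A * C"
  proof (cases "C = 0")
    case True
    have "B = 0"
    proof (rule ccontr)
      assume "B \<noteq> 0"
      thus False using assms(1)[of "- (A + 1) / (2 * B)"] True by (simp add: field_simps)
    qed
    thus ?thesis using True by simp
  next
    case False
    hence "0 < C" using assms(2) by simp
    moreover have "0 \<le> A + 2 * (- B / C) * B + (- B / C)\<^sup>2 * C" by (rule assms(1))
    hence "0 \<le> A - B\<^sup>2 / C" using False by (simp add: field_simps power2_eq_square)
    ultimately show ?thesis by (simp add: field_simps)
  qed
  thus ?thesis using real_le_rsqrt[of "\<bar>B\<bar>" "A * C"] by (simp add: real_sqrt_mult)
qed

text \<open>The main step. Row \<open>i\<close> may have both signs. The entry \<open>a i k\<close> is lowered to some \<open>s\<close> for which the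
  Schur complement of \<open>a i i\<close> is copositive of order 3. Write \<open>D = a i i\<close>, let \<open>q\<close> be the form on
  \<open>{j, k, l}\<close>, and \<open>m = a i j x + a i l z\<close>. The requirement is \<open>(m + s y)\<^sup>2 \<le> D q(x, y, z)\<close> for all
  nonnegative arguments, which for \<open>y = 1\<close> says that \<open>s\<close> lies in the interval with end points
  \<open>- m - sqrt (D q)\<close> and \<open>- m + sqrt (D q)\<close>. Copositivity puts all left end points below \<open>a i k\<close>. That
  every left end point is below every right end point follows from the triangle inequality for the
  seminorm obtained from \<open>q\<close> by replacing \<open>a j l\<close> with a number \<open>t\<close> not above it: the replaced form is assumed
  positive semidefinite, it is at most \<open>q\<close> at nonnegative arguments, and \<open>D\<close> times it dominates \<open>m\<^sup>2\<close> when
  \<open>y = 0\<close>. So the supremum of the left end points serves as \<open>s\<close>.\<close>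

lemma spn_on_pivot:
  assumes dist: "distinct [i, j, k, l]" and sym: "symmetric_on {i, j, k, l} a"
    and cop: "copositive_on {i, j, k, l} a" and pos: "0 < a i i" and t: "t \<le> a j l"
    and psd1: "\<And>x z. (a i j * x + a i l * z)\<^sup>2 \<le> a i i * (a j j * x\<^sup>2 + 2 * t * x * z + a l l * z\<^sup>2)"
    and psd2: "\<And>x y z. 0 \<le> a j j * x\<^sup>2 + a k k * y\<^sup>2 + a l l * z\<^sup>2
                 + 2 * a j k * x * y + 2 * a k l * y * z + 2 * t * x * z"
  shows "spn_on {i, j, k, l} a"
proof -
  let ?D = "a i i"
  \<comment> \<open>The form on \<open>{j, k, l}\<close> with the entry \<open>a j l\<close> replaced by \<open>m\<close>.\<close>
  define q where "q m x y z = a j j * x\<^sup>2 + a k k * y\<^sup>2 + a l l * z\<^sup>2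
      + 2 * a j k * x * y + 2 * a k l * y * z + 2 * m * x * z" for m x y z :: real
  define r where "r x y z = sqrt (?D * q (a j l) x y z)" for x y z
  define r' where "r' x y z = sqrt (?D * q t x y z)" for x y z
  have d': "i \<noteq> j" "i \<noteq> k" "i \<noteq> l" "j \<noteq> k" "j \<noteq> l" "k \<noteq> l" using dist by auto
  have sym3: "symmetric_on {j, k, l} a" by (rule symmetric_on_mono[OF sym]) auto
  have q: "quad_form {j, k, l} a x = q (a j l) (x j) (x k) (x l)" for x
    using dist by (subst quad_form_3[OF _ sym3]) (auto simp: q_def)
  have q_mono: "q t x y z \<le> q (a j l) x y z" if "0 \<le> x" "0 \<le> z" for x y z
  proof -
    have "t * (x * z) \<le> a j l * (x * z)" using t that by (intro mult_right_mono) auto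
    thus ?thesis by (simp add: q_def mult.assoc)
  qed
  have r'_le: "r' x y z \<le> r x y z" if "0 \<le> x" "0 \<le> z" for x y z
    unfolding r_def r'_def using q_mono[OF that] pos by simp
  have q'_nonneg: "0 \<le> q t x y z" for x y z using psd2[of x y z] by (simp add: q_def)
  have r_nonneg: "0 \<le> r x y z" if "0 \<le> x" "0 \<le> z" for x y z
    unfolding r_def using q_mono[OF that, of y] q'_nonneg[of x y z] pos by simp
  have lower: "- (a i j * x + a i k * y + a i l * z) \<le> r x y z" if "0 \<le> x" "0 \<le> y" "0 \<le> z" for x y z
  proof (cases "0 \<le> a i j * x + a i k * y + a i l * z")
    case True
    thus ?thesis using r_nonneg[OF that(1,3), of y] by linarith
  next
    case False
    define s where "s = a i j * x + a i k * y + a i l * z"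
    \<comment> \<open>At the value of the pivot variable that minimises the form.\<close>
    define w where "w v = (if v = i then - s / ?D else if v = j then x else if v = k then y else z)" for v
    have w: "w i = - s / ?D" "w j = x" "w k = y" "w l = z" using d' by (auto simp: w_def)
    have "0 \<le> w i" using False pos by (simp add: w s_def divide_nonpos_pos)
    hence "0 \<le> quad_form {i, j, k, l} a w"
      using that w by (intro copositive_onD[OF cop]) auto
    also have "\<dots> = ?D * (s / ?D)\<^sup>2 - 2 * s / ?D * s + q (a j l) x y z"
      unfolding quad_form_4[OF dist sym] q w s_def[symmetric] by (simp add: power_divide)
    also have "\<dots> = q (a j l) x y z - s\<^sup>2 / ?D" using pos by (simp add: field_simps power2_eq_square)
    finally have "s\<^sup>2 \<le> ?D * q (a j l) x y z" using pos by (simp add: field_simps)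
    hence "(- s)\<^sup>2 \<le> ?D * q (a j l) x y z" by simp
    hence "- s \<le> r x y z" unfolding r_def by (rule real_le_rsqrt)
    thus ?thesis by (simp add: s_def)
  qed
  have triangle: "r' (x' - x) 0 (z' - z) \<le> r' x 1 z + r' x' 1 z'" for x z x' z'
  proof -
    \<comment> \<open>The bilinear form of \<open>q t\<close> at \<open>(x, 1, z)\<close> and \<open>(x', 1, z')\<close>.\<close>
    define B where "B = a j j * x * x' + a k k + a l l * z * z' + a j k * (x + x') + a k l * (z + z')
      + t * (x * z' + x' * z)"
    have "\<bar>B\<bar> \<le> sqrt (q t x 1 z) * sqrt (q t x' 1 z')"
    proof (rule psd_cauchy_schwarz)
      fix u :: real
      have "q t x 1 z + 2 * u * B + u\<^sup>2 * q t x' 1 z' = q t (x + u * x') (1 + u * 1) (z + u * z')"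
        unfolding q_def B_def by (simp add: power2_eq_square algebra_simps)
      thus "0 \<le> q t x 1 z + 2 * u * B + u\<^sup>2 * q t x' 1 z'" using q'_nonneg by simp
    qed (rule q'_nonneg)
    moreover have "q t (x' - x) 0 (z' - z) = q t x 1 z - 2 * B + q t x' 1 z'"
      unfolding q_def B_def by (simp add: power2_eq_square algebra_simps)
    ultimately have "q t (x' - x) 0 (z' - z) \<le> (sqrt (q t x 1 z) + sqrt (q t x' 1 z'))\<^sup>2"
      using q'_nonneg by (simp add: power2_sum) (simp add: abs_le_iff mult.commute)
    hence "sqrt (q t (x' - x) 0 (z' - z)) \<le> sqrt (q t x 1 z) + sqrt (q t x' 1 z')"
      using q'_nonneg by (intro real_le_lsqrt) auto
    hence "sqrt ?D * sqrt (q t (x' - x) 0 (z' - z)) \<le> sqrt ?D * (sqrt (q t x 1 z) + sqrt (q t x' 1 z'))"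
      using pos by (intro mult_left_mono) auto
    thus ?thesis by (simp add: r'_def real_sqrt_mult algebra_simps)
  qed
  have upper: "a i j * (x' - x) + a i l * (z' - z) \<le> r x 1 z + r x' 1 z'"
    if "0 \<le> x" "0 \<le> z" "0 \<le> x'" "0 \<le> z'" for x z x' z'
  proof -
    have "a i j * (x' - x) + a i l * (z' - z) \<le> r' (x' - x) 0 (z' - z)"
      unfolding r'_def using psd1[of "x' - x" "z' - z"] by (intro real_le_rsqrt) (simp add: q_def algebra_simps)
    also note triangle
    also have "r' x 1 z + r' x' 1 z' \<le> r x 1 z + r x' 1 z'" using r'_le that by (intro add_mono) auto
    finally show ?thesis .
  qed
  \<comment> \<open>The left end points for \<open>y = 1\<close>.\<close>
  define L where "L = {- (a i j * x + a i l * z) - r x 1 z | x z. 0 \<le> x \<and> 0 \<le> z}"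
  define s where "s = Sup L"
  have bdd: "w \<le> a i k" if "w \<in> L" for w
  proof -
    from that obtain x z where "w = - (a i j * x + a i l * z) - r x 1 z" "0 \<le> x" "0 \<le> z"
      by (auto simp: L_def)
    thus ?thesis using lower[of x 1 z] by simp
  qed
  have ne: "L \<noteq> {}" by (auto simp: L_def)
  have s_le: "s \<le> a i k" unfolding s_def by (rule cSup_least[OF ne bdd])
  have s_lower: "- (a i j * x + a i l * z) - r x 1 z \<le> s" if "0 \<le> x" "0 \<le> z" for x z
    unfolding s_def
  proof (rule cSup_upper)
    show "- (a i j * x + a i l * z) - r x 1 z \<in> L" using that by (auto simp: L_def)
    show "bdd_above L" using bdd by (auto simp: bdd_above_def)
  qed
  have s_upper: "s \<le> - (a i j * x + a i l * z) + r x 1 z" if "0 \<le> x" "0 \<le> z" for x z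
    unfolding s_def
  proof (rule cSup_least[OF ne])
    fix w assume "w \<in> L"
    then obtain x' z' where "w = - (a i j * x' + a i l * z') - r x' 1 z'" "0 \<le> x'" "0 \<le> z'"
      by (auto simp: L_def)
    thus "w \<le> - (a i j * x + a i l * z) + r x 1 z"
      using upper[OF \<open>0 \<le> x'\<close> \<open>0 \<le> z'\<close> that] by (simp add: algebra_simps)
  qed
  have bound1: "(a i j * x + s + a i l * z)\<^sup>2 \<le> ?D * q (a j l) x 1 z" if "0 \<le> x" "0 \<le> z" for x z
  proof -
    have "\<bar>a i j * x + s + a i l * z\<bar> \<le> r x 1 z"
      using s_lower[OF that] s_upper[OF that] by (simp add: abs_le_iff)
    hence "(a i j * x + s + a i l * z)\<^sup>2 \<le> (r x 1 z)\<^sup>2"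
      using r_nonneg[OF that] by (metis abs_le_square_iff abs_of_nonneg)
    also have "\<dots> = ?D * q (a j l) x 1 z"
      unfolding r_def using q_mono[OF that, of 1] q'_nonneg[of x 1 z] pos by simp
    finally show ?thesis .
  qed
  have bound: "(a i j * x + s * y + a i l * z)\<^sup>2 \<le> ?D * q (a j l) x y z"
    if "0 \<le> x" "0 \<le> y" "0 \<le> z" for x y z
  proof (cases "y = 0")
    case True
    have "(a i j * x + a i l * z)\<^sup>2 \<le> ?D * q t x 0 z" using psd1[of x z] by (simp add: q_def algebra_simps)
    also have "\<dots> \<le> ?D * q (a j l) x 0 z" using q_mono[OF that(1,3)] pos by simp
    finally show ?thesis using True by simp
  next
    case False
    hence y: "0 < y" using that by simp
    have "y\<^sup>2 * (a i j * (x / y) + s + a i l * (z / y))\<^sup>2 \<le> y\<^sup>2 * (?D * q (a j l) (x / y) 1 (z / y))"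
      using that by (intro mult_left_mono bound1) auto
    moreover have "y\<^sup>2 * (a i j * (x / y) + s + a i l * (z / y))\<^sup>2 = (a i j * x + s * y + a i l * z)\<^sup>2"
    proof -
      have "y * (a i j * (x / y) + s + a i l * (z / y)) = a i j * x + s * y + a i l * z"
        using y by (simp add: field_simps)
      thus ?thesis unfolding power_mult_distrib[symmetric] by simp
    qed
    moreover have "y\<^sup>2 * q (a j l) (x / y) 1 (z / y) = q (a j l) x y z"
      unfolding q_def using y by (simp add: field_simps power2_eq_square)
    ultimately show ?thesis by (simp add: mult.left_commute)
  qed
  define b where "b u v = (if {u, v} = {i, k} then s else a u v)" for u v
  have sb: "symmetric_on {i, j, k, l} b"
    unfolding symmetric_on_def b_def using symmetric_onD[OF sym] by (auto simp: insert_commute)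
  have S: "{i, j, k, l} - {i} = {j, k, l}" using dist by auto
  have bi: "b i i = ?D" "b i j = a i j" "b i k = s" "b i l = a i l"
    using d' by (auto simp: b_def doubleton_eq_iff)
  have brest: "b u v = a u v" if "u \<in> {j, k, l}" "v \<in> {j, k, l}" for u v
    using d' that by (auto simp: b_def doubleton_eq_iff)
  have "copositive_on {j, k, l} (schur_on i b)"
    unfolding copositive_on_def
  proof (intro allI impI)
    fix x :: "'a \<Rightarrow> real" assume x: "\<forall>v\<in>{j, k, l}. 0 \<le> x v"
    define m where "m = a i j * x j + s * x k + a i l * x l"
    have "quad_form {i, j, k, l} b x = ?D * (x i + m / ?D)\<^sup>2 + quad_form {j, k, l} (schur_on i b) x"
      using quad_form_schur[of "{i, j, k, l}" i b x] sb pos d' unfolding S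
      by (simp add: bi m_def add.assoc)
    moreover have "quad_form {i, j, k, l} b x = ?D * (x i)\<^sup>2 + 2 * x i * m + q (a j l) (x j) (x k) (x l)"
      unfolding quad_form_4[OF dist sb] bi m_def q[symmetric]
      by (simp only: quad_form_cong[of "{j, k, l}" b a x x, OF brest refl])
    moreover have "?D * (x i + m / ?D)\<^sup>2 = ?D * (x i)\<^sup>2 + 2 * x i * m + m\<^sup>2 / ?D"
      using pos by (simp add: field_simps power2_eq_square)
    moreover have "m\<^sup>2 / ?D \<le> q (a j l) (x j) (x k) (x l)"
      using bound[of "x j" "x k" "x l"] x pos unfolding m_def by (simp add: field_simps)
    ultimately show "0 \<le> quad_form {j, k, l} (schur_on i b) x" by linarith
  qed
  hence "spn_on {j, k, l} (schur_on i b)"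
    using d' symmetric_on_mono[OF symmetric_on_schur[OF sb, of i], of "{j, k, l}"]
    by (intro spn_on_card_le_3) auto
  hence "spn_on {i, j, k, l} b"
    using spn_on_schur[OF _ sb, of i] pos unfolding S by (simp add: bi)
  thus ?thesis
  proof (rule spn_on_mono)
    fix u v assume uv: "u \<in> {i, j, k, l}" "v \<in> {i, j, k, l}"
    show "b u v \<le> a u v"
      using s_le symmetric_onD[OF sym uv] by (auto simp: b_def doubleton_eq_iff)
  qed
qed

section \<open>Angles and semidefinite matrices of order 4\<close>

text \<open>The three angles satisfy the spherical triangle inequalities; the conclusion states that the
  matrix with unit diagonal and off-diagonal entries \<open>cos x\<close>, \<open>cos y\<close>, \<open>cos t\<close> is positive semidefinite.\<close>

lemma abs_cos_diff_le:
  fixes x y t :: real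
  assumes "0 \<le> t" "t \<le> pi" "\<bar>x - y\<bar> \<le> t" "t \<le> x + y" "x + y + t \<le> 2 * pi"
  shows "\<bar>cos t - cos x * cos y\<bar> \<le> sin x * sin y"
proof -
  have "cos t \<le> cos \<bar>x - y\<bar>" using assms by (intro cos_monotone_0_pi_le) auto
  hence 1: "cos t \<le> cos x * cos y + sin x * sin y" by (simp add: cos_diff)
  have "cos (x + y) \<le> cos t"
  proof (cases "x + y \<le> pi")
    case True
    thus ?thesis using assms by (intro cos_monotone_0_pi_le) auto
  next
    case False
    have "cos (2 * pi - (x + y)) \<le> cos t" using assms False by (intro cos_monotone_0_pi_le) auto
    thus ?thesis by (simp only: cos_2pi_minus)
  qed
  with 1 show ?thesis by (auto simp: cos_add abs_le_iff)
qed

lemma binary_form_nonneg: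
  fixes m p r X Y :: real
  assumes "\<bar>m\<bar> \<le> p * r"
  shows "0 \<le> (p * X)\<^sup>2 + 2 * (m * (X * Y)) + (r * Y)\<^sup>2"
proof -
  have "\<bar>m * (X * Y)\<bar> \<le> p * r * \<bar>X * Y\<bar>"
    unfolding abs_mult[of m] by (intro mult_right_mono assms) auto
  also have "\<dots> \<le> \<bar>p * X\<bar> * \<bar>r * Y\<bar>"
    using mult_right_mono[OF abs_ge_self[of "p * r"], of "\<bar>X * Y\<bar>"] by (simp add: abs_mult mult_ac)
  finally have "- (m * (X * Y)) \<le> \<bar>p * X\<bar> * \<bar>r * Y\<bar>" by linarith
  moreover have "0 \<le> (\<bar>p * X\<bar> - \<bar>r * Y\<bar>)\<^sup>2" by simp
  hence "2 * (\<bar>p * X\<bar> * \<bar>r * Y\<bar>) \<le> (p * X)\<^sup>2 + (r * Y)\<^sup>2" by (simp add: power2_diff)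
  ultimately show ?thesis by linarith
qed

lemma square_cos_sum_le:
  fixes x y X Y m :: real
  assumes "\<bar>m - cos x * cos y\<bar> \<le> sin x * sin y"
  shows "(cos x * X + cos y * Y)\<^sup>2 \<le> X\<^sup>2 + 2 * m * X * Y + Y\<^sup>2"
proof -
  have "(sin x * X)\<^sup>2 + 2 * ((m - cos x * cos y) * (X * Y)) + (sin y * Y)\<^sup>2
      = X\<^sup>2 + 2 * m * X * Y + Y\<^sup>2 - (cos x * X + cos y * Y)\<^sup>2"
    unfolding power_mult_distrib sin_squared_eq by (simp add: power2_eq_square algebra_simps)
  thus ?thesis using binary_form_nonneg[OF assms, of X Y] by linarith
qed

text \<open>The case in which the angles of the 4-cycle \<open>i, j, k, l\<close> are the sides of a spherical quadrilateral
  (none exceeds the sum of the other three, and the total is at most \<open>2 \<pi>\<close>). The number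
  \<open>\<tau> = min (\<alpha> + \<delta>) (\<beta> + \<gamma>)\<close> is a possible length of the diagonal, that is, it completes both \<open>(\<alpha>, \<delta>)\<close> and
  \<open>(\<beta>, \<gamma>)\<close> to a spherical triangle, and it yields an entry not above \<open>a j l\<close>.\<close>

lemma spn_on_polygon:
  fixes d :: "'a \<Rightarrow> real"
  assumes dist: "distinct [i, j, k, l]" and sym: "symmetric_on {i, j, k, l} a"
    and cop: "copositive_on {i, j, k, l} a"
    and diag: "\<And>v. v \<in> {i, j, k, l} \<Longrightarrow> 0 < d v \<and> a v v = (d v)\<^sup>2"
    and ij: "a i j = - (d i * d j * cos \<alpha>)" and jk: "a j k = - (d j * d k * cos \<beta>)"
    and kl: "a k l = - (d k * d l * cos \<gamma>)" and il: "a i l = - (d i * d l * cos \<delta>)"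
    and jl: "d j * d l * cos (\<alpha> + \<delta>) \<le> a j l" "d j * d l * cos (\<beta> + \<gamma>) \<le> a j l"
    and ge: "0 \<le> \<alpha>" "0 \<le> \<beta>" "0 \<le> \<gamma>" "0 \<le> \<delta>"
    and le: "\<beta> + \<gamma> \<le> pi" "\<alpha> + \<beta> + \<gamma> + \<delta> \<le> 2 * pi"
    and polygon: "\<alpha> \<le> \<beta> + \<gamma> + \<delta>" "\<beta> \<le> \<alpha> + \<gamma> + \<delta>" "\<gamma> \<le> \<alpha> + \<beta> + \<delta>" "\<delta> \<le> \<alpha> + \<beta> + \<gamma>"
  shows "spn_on {i, j, k, l} a"
proof -
  define \<tau> where "\<tau> = min (\<alpha> + \<delta>) (\<beta> + \<gamma>)"
  have 1: "\<bar>cos \<tau> - cos \<alpha> * cos \<delta>\<bar> \<le> sin \<alpha> * sin \<delta>"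
    by (rule abs_cos_diff_le) (use ge le polygon in \<open>auto simp: \<tau>_def\<close>)
  have 2: "\<bar>cos \<tau> - cos \<beta> * cos \<gamma>\<bar> \<le> sin \<beta> * sin \<gamma>"
    by (rule abs_cos_diff_le) (use ge le polygon in \<open>auto simp: \<tau>_def\<close>)
  show ?thesis
  proof (rule spn_on_pivot[OF dist sym cop, where t = "d j * d l * cos \<tau>"])
    show "0 < a i i" using diag[of i] by simp
    show "d j * d l * cos \<tau> \<le> a j l" using jl by (simp add: \<tau>_def min_def)
  next
    fix x z :: real
    have "(d i)\<^sup>2 * (cos \<alpha> * (d j * x) + cos \<delta> * (d l * z))\<^sup>2
        \<le> (d i)\<^sup>2 * ((d j * x)\<^sup>2 + 2 * cos \<tau> * (d j * x) * (d l * z) + (d l * z)\<^sup>2)"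
      by (intro mult_left_mono square_cos_sum_le 1) auto
    thus "(a i j * x + a i l * z)\<^sup>2
        \<le> a i i * (a j j * x\<^sup>2 + 2 * (d j * d l * cos \<tau>) * x * z + a l l * z\<^sup>2)"
      using diag by (simp add: ij il power2_eq_square algebra_simps)
  next
    fix x y z :: real
    have "(cos \<beta> * (d j * x) + cos \<gamma> * (d l * z))\<^sup>2
        \<le> (d j * x)\<^sup>2 + 2 * cos \<tau> * (d j * x) * (d l * z) + (d l * z)\<^sup>2"
      by (intro square_cos_sum_le 2)
    moreover have "0 \<le> (d k * y - cos \<beta> * (d j * x) - cos \<gamma> * (d l * z))\<^sup>2" by simp
    ultimately show "0 \<le> a j j * x\<^sup>2 + a k k * y\<^sup>2 + a l l * z\<^sup>2
        + 2 * a j k * x * y + 2 * a k l * y * z + 2 * (d j * d l * cos \<tau>) * x * z"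
      using diag by (simp add: jk kl power2_eq_square algebra_simps)
  qed
qed

lemma spn_on_planar_gram:
  assumes "finite S" "\<And>u v. u \<in> S \<Longrightarrow> v \<in> S \<Longrightarrow> f u * f v + g u * g v \<le> a u v"
  shows "spn_on S a"
proof -
  have "quad_form S (\<lambda>u v. f u * f v + g u * g v) x = (\<Sum>u\<in>S. f u * x u)\<^sup>2 + (\<Sum>u\<in>S. g u * x u)\<^sup>2" for x
    unfolding quad_form_def power2_eq_square sum_product sum.distrib[symmetric]
    by (intro sum.cong refl) (simp add: algebra_simps)
  thus ?thesis
    unfolding spn_on_def using assms(2)
    by (intro exI[of _ "\<lambda>u v. f u * f v + g u * g v"]) (auto simp: symmetric_on_def mult.commute)
qed

text \<open>Vectors of length \<open>d v\<close> in the plane, at the angles \<open>0\<close>, \<open>\<alpha>\<close>, \<open>\<alpha> + \<beta>\<close>, \<open>\<alpha> + \<beta> + \<gamma>\<close> with alternating signs, have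
  exactly the prescribed inner products along the path \<open>i, j, k, l\<close>.\<close>

lemma spn_on_planar:
  fixes d :: "'a \<Rightarrow> real"
  assumes dist: "distinct [i, j, k, l]" and sym: "symmetric_on {i, j, k, l} a"
    and diag: "\<And>v. v \<in> {i, j, k, l} \<Longrightarrow> 0 < d v \<and> a v v = (d v)\<^sup>2"
    and ij: "a i j = - (d i * d j * cos \<alpha>)" and jk: "a j k = - (d j * d k * cos \<beta>)"
    and kl: "a k l = - (d k * d l * cos \<gamma>)"
    and ik: "d i * d k * cos (\<alpha> + \<beta>) \<le> a i k" and jl: "d j * d l * cos (\<beta> + \<gamma>) \<le> a j l"
    and il: "- (d i * d l * cos (\<alpha> + \<beta> + \<gamma>)) \<le> a i l"
  shows "spn_on {i, j, k, l} a"
proof -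
  have d': "i \<noteq> j" "i \<noteq> k" "i \<noteq> l" "j \<noteq> k" "j \<noteq> l" "k \<noteq> l" using dist by auto
  define \<theta> where "\<theta> v = (if v = i then 0 else if v = j then \<alpha> else if v = k then \<alpha> + \<beta> else \<alpha> + \<beta> + \<gamma>)" for v
  define e where "e v = (if v = j \<or> v = l then - d v else d v)" for v
  have th: "\<theta> i = 0" "\<theta> j = \<alpha>" "\<theta> k = \<alpha> + \<beta>" "\<theta> l = \<alpha> + \<beta> + \<gamma>"
    and e: "e i = d i" "e j = - d j" "e k = d k" "e l = - d l"
    using d' by (auto simp: \<theta>_def e_def)
  have gram: "(e u * cos (\<theta> u)) * (e v * cos (\<theta> v)) + (e u * sin (\<theta> u)) * (e v * sin (\<theta> v))
      = e u * e v * cos (\<theta> v - \<theta> u)" for u v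
    by (simp add: cos_diff algebra_simps)
  have comm: "e u * e v * cos (\<theta> v - \<theta> u) = e v * e u * cos (\<theta> u - \<theta> v)" for u v
    by (subst cos_minus[symmetric]) (simp add: mult.commute)
  have dg: "e u * e u * cos (\<theta> u - \<theta> u) \<le> a u u" if "u \<in> {i, j, k, l}" for u
    using diag[OF that] by (simp add: e_def power2_eq_square)
  have up: "e i * e j * cos (\<theta> j - \<theta> i) \<le> a i j" "e i * e k * cos (\<theta> k - \<theta> i) \<le> a i k"
    "e i * e l * cos (\<theta> l - \<theta> i) \<le> a i l" "e j * e k * cos (\<theta> k - \<theta> j) \<le> a j k"
    "e j * e l * cos (\<theta> l - \<theta> j) \<le> a j l" "e k * e l * cos (\<theta> l - \<theta> k) \<le> a k l"
    using ij jk kl ik jl il unfolding th e by (auto simp: algebra_simps)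
  have dn: "a j i = a i j" "a k i = a i k" "a l i = a i l" "a k j = a j k" "a l j = a j l" "a l k = a k l"
    by (auto intro: symmetric_onD[OF sym])
  have up': "e j * e i * cos (\<theta> i - \<theta> j) \<le> a j i" "e k * e i * cos (\<theta> i - \<theta> k) \<le> a k i"
    "e l * e i * cos (\<theta> i - \<theta> l) \<le> a l i" "e k * e j * cos (\<theta> j - \<theta> k) \<le> a k j"
    "e l * e j * cos (\<theta> j - \<theta> l) \<le> a l j" "e l * e k * cos (\<theta> k - \<theta> l) \<le> a l k"
    unfolding dn using up comm by metis+
  show ?thesis
  proof (rule spn_on_planar_gram, simp)
    fix u v assume "u \<in> {i, j, k, l}" "v \<in> {i, j, k, l}"
    hence "e u * e v * cos (\<theta> v - \<theta> u) \<le> a u v"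
      using up up' dg by (elim insertE emptyE) (simp_all only: insert_iff simp_thms)
    thus "(e u * cos (\<theta> u)) * (e v * cos (\<theta> v)) + (e u * sin (\<theta> u)) * (e v * sin (\<theta> v)) \<le> a u v"
      unfolding gram .
  qed
qed

lemma copositive_on_pair_lower:
  assumes "symmetric_on {u, v} b" "copositive_on {u, v} b" "u \<noteq> v"
    and "0 \<le> p" "0 \<le> r" "b u u = p\<^sup>2" "b v v = r\<^sup>2"
  shows "- (p * r) \<le> b u v"
proof (cases "p = 0 \<or> r = 0")
  case True
  have "b v u = b u v" using symmetric_onD[OF assms(1), of v u] by simp
  hence "0 \<le> b u v"
    using True copositive_on_offdiag_nonneg[OF _ assms(1,2), of u v]
      copositive_on_offdiag_nonneg[OF _ assms(1,2), of v u] assms(6,7) by auto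
  thus ?thesis using assms(4,5) mult_nonneg_nonneg[of p r] by linarith
next
  case False
  \<comment> \<open>The vector at which \<open>(p x u - r x v)\<^sup>2\<close> vanishes.\<close>
  define x where "x w = (if w = u then r else p)" for w
  have "0 \<le> quad_form {u, v} b x"
    using assms(4,5) by (intro copositive_onD[OF assms(2)]) (auto simp: x_def)
  also have "\<dots> = 2 * (p * r) * (p * r + b u v)"
    using assms(3,6,7) symmetric_onD[OF assms(1), of v u]
    by (simp add: quad_form_def x_def power2_eq_square algebra_simps)
  finally have "0 \<le> (p * r) * (p * r + b u v)" by simp
  moreover have "0 < p * r" using False assms(4,5) by simp
  ultimately show ?thesis by (simp add: zero_le_mult_iff)
qed

lemma copositive_on_offdiag_abs_le:
  assumes "finite S" "symmetric_on S a" "copositive_on S a"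
    and diag: "\<And>w. w \<in> S \<Longrightarrow> 0 < d w \<and> a w w = (d w)\<^sup>2"
    and "u \<in> S" "v \<in> S" "u \<noteq> v" "a u v \<le> 0"
  shows "\<bar>a u v\<bar> \<le> d u * d v"
proof -
  have "- (d u * d v) \<le> a u v"
  proof (rule copositive_on_pair_lower[where b = a and u = u and v = v])
    show "symmetric_on {u, v} a" by (rule symmetric_on_mono[OF assms(2)]) (use assms in auto)
    show "copositive_on {u, v} a" by (rule copositive_on_subset[OF assms(1,3)]) (use assms in auto)
  qed (use assms(7) diag[OF assms(5)] diag[OF assms(6)] in auto)
  thus ?thesis using assms(8) by simp
qed

text \<open>Copositivity of a principal submatrix of order 3 in which row \<open>c\<close> is nonpositive: two entries with
  angles \<open>x\<close> and \<open>y\<close> bound the third one below by the one with angle \<open>\<pi> - (x + y)\<close>.\<close>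

lemma copositive_on_cos_lower:
  fixes d :: "'a \<Rightarrow> real"
  assumes "finite S" "symmetric_on S a" "copositive_on S a" "{c, u, v} \<subseteq> S" "distinct [c, u, v]"
    and diag: "\<And>w. w \<in> S \<Longrightarrow> 0 < d w \<and> a w w = (d w)\<^sup>2"
    and cu: "a c u = - (d c * d u * cos x)" "0 \<le> x" "x \<le> pi / 2"
    and cv: "a c v = - (d c * d v * cos y)" "0 \<le> y" "y \<le> pi / 2"
  shows "d u * d v * cos (x + y) \<le> a u v"
proof -
  have sym: "symmetric_on {c, u, v} a" by (rule symmetric_on_mono[OF assms(2,4)])
  have cop: "copositive_on {c, u, v} a" by (rule copositive_on_subset[OF assms(1,3,4)])
  have S: "{c, u, v} - {c} = {u, v}" using assms(5) by auto
  have dc: "0 < d c" "a c c = (d c)\<^sup>2" and du: "0 < d u" "a u u = (d u)\<^sup>2"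
    and dv: "0 < d v" "a v v = (d v)\<^sup>2" using diag assms(4) by auto
  have cos: "0 \<le> cos x" "0 \<le> cos y" using cu cv by (auto intro: cos_ge_zero)
  have sin: "0 \<le> sin x" "0 \<le> sin y" using cu cv by (auto intro: sin_ge_zero)
  have sw: "a u c = a c u" "a v c = a c v" by (auto intro: symmetric_onD[OF sym])
  have "- ((d u * sin x) * (d v * sin y)) \<le> schur_on c a u v"
  proof (rule copositive_on_pair_lower[where b = "schur_on c a" and u = u and v = v])
    show "symmetric_on {u, v} (schur_on c a)"
      by (rule symmetric_on_mono[OF symmetric_on_schur[OF sym]]) auto
    have "a c w \<le> 0" if "w \<in> {c, u, v}" "w \<noteq> c" for w
      using that cu(1) cv(1) cos dc du dv by auto
    thus "copositive_on {u, v} (schur_on c a)"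
      using copositive_on_schur[OF _ sym cop, of c] dc unfolding S by auto
    show "schur_on c a u u = (d u * sin x)\<^sup>2" "schur_on c a v v = (d v * sin y)\<^sup>2"
      unfolding schur_on_def sw cu(1) cv(1) dc du dv power_mult_distrib sin_squared_eq
      using dc(1) by (auto simp: field_simps power2_eq_square)
  qed (use sin du dv assms(5) in auto)
  also have "schur_on c a u v = a u v - d u * d v * (cos x * cos y)"
    unfolding schur_on_def sw cu(1) cv(1) dc(2) using dc(1) by (simp add: field_simps power2_eq_square)
  finally show ?thesis by (simp add: cos_add algebra_simps)
qed

text \<open>The angle of an off-diagonal entry \<open>m\<close>, with \<open>c\<close> the geometric mean of the two diagonal entries. The
  sign is chosen so that nonpositive entries have angles in \<open>[0, \<pi> / 2]\<close>.\<close>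

lemma exists_angle:
  fixes m c :: real
  assumes "\<bar>m\<bar> \<le> c" "0 < c"
  obtains x where "0 \<le> x" "x \<le> pi" "m = - (c * cos x)" "m \<le> 0 \<Longrightarrow> x \<le> pi / 2" "0 \<le> m \<Longrightarrow> pi / 2 \<le> x"
proof
  let ?x = "arccos (- m / c)"
  have r: "-1 \<le> - m / c" "- m / c \<le> 1" using assms by (auto simp: field_simps abs_le_iff)
  show "0 \<le> ?x" "?x \<le> pi" using r by (auto intro: arccos_lbound arccos_ubound)
  show "m = - (c * cos ?x)" using r assms(2) by (simp add: cos_arccos)
  show "?x \<le> pi / 2" if "m \<le> 0" using r that assms(2) by (intro arccos_le_pi2) (auto simp: field_simps)
  show "pi / 2 \<le> ?x" if "0 \<le> m"
    using arccos_le_arccos[of "- m / c" 0] r that assms(2) by (simp add: field_simps)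
qed

text \<open>Here the semidefinite part is tridiagonal along the path \<open>i, j, k, l\<close>: eliminating the two end variables
  leaves a binary form with diagonal \<open>sin\<^sup>2 \<alpha>\<close>, \<open>sin\<^sup>2 \<gamma>\<close> and off-diagonal entry \<open>- m\<close>, up to scaling.\<close>

lemma spn_on_tridiagonal:
  fixes d :: "'a \<Rightarrow> real"
  assumes dist: "distinct [i, j, k, l]" and sym: "symmetric_on {i, j, k, l} a"
    and diag: "\<And>v. v \<in> {i, j, k, l} \<Longrightarrow> 0 < d v \<and> a v v = (d v)\<^sup>2"
    and ij: "a i j = - (d i * d j * cos \<alpha>)" and kl: "a k l = - (d k * d l * cos \<gamma>)"
    and jk: "- (d j * d k * m) \<le> a j k" "\<bar>m\<bar> \<le> sin \<alpha> * sin \<gamma>"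
    and nonneg: "0 \<le> a i k" "0 \<le> a i l" "0 \<le> a j l"
  shows "spn_on {i, j, k, l} a"
proof -
  have d': "i \<noteq> j" "i \<noteq> k" "i \<noteq> l" "j \<noteq> k" "j \<noteq> l" "k \<noteq> l" using dist by auto
  define p where "p u v = (if u = v \<or> {u, v} = {i, j} \<or> {u, v} = {k, l} then a u v
      else if {u, v} = {j, k} then - (d j * d k * m) else 0)" for u v
  have symp: "symmetric_on {i, j, k, l} p"
    unfolding symmetric_on_def p_def using symmetric_onD[OF sym] by (auto simp: insert_commute)
  have p: "p i i = a i i" "p j j = a j j" "p k k = a k k" "p l l = a l l"
    "p i j = a i j" "p k l = a k l" "p j k = - (d j * d k * m)" "p i k = 0" "p i l = 0" "p j l = 0"
    using d' by (auto simp: p_def doubleton_eq_iff)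
  have le: "p i j \<le> a i j" "p i k \<le> a i k" "p i l \<le> a i l" "p j k \<le> a j k" "p j l \<le> a j l" "p k l \<le> a k l"
    "p i i \<le> a i i" "p j j \<le> a j j" "p k k \<le> a k k" "p l l \<le> a l l"
    using jk nonneg by (auto simp: p)
  have sp: "p j i = p i j" "p k i = p i k" "p l i = p i l" "p k j = p j k" "p l j = p j l" "p l k = p k l"
    by (auto intro: symmetric_onD[OF symp])
  have sa: "a j i = a i j" "a k i = a i k" "a l i = a i l" "a k j = a j k" "a l j = a j l" "a l k = a k l"
    by (auto intro: symmetric_onD[OF sym])
  have "p u v \<le> a u v" if "u \<in> {i, j, k, l}" "v \<in> {i, j, k, l}" for u v
    using that le by (elim insertE emptyE) (simp_all only: sp sa)
  moreover have "0 \<le> quad_form {i, j, k, l} p x" for x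
  proof -
    define X where "X v = d v * x v" for v
    have sym3: "symmetric_on {j, k, l} p" by (rule symmetric_on_mono[OF symp]) auto
    have "0 \<le> (sin \<alpha> * X j)\<^sup>2 + 2 * (- m * (X j * X k)) + (sin \<gamma> * X k)\<^sup>2"
      using jk(2) by (intro binary_form_nonneg) simp
    also have "\<dots> \<le> (X i - cos \<alpha> * X j)\<^sup>2 + (X l - cos \<gamma> * X k)\<^sup>2
        + ((sin \<alpha> * X j)\<^sup>2 + 2 * (- m * (X j * X k)) + (sin \<gamma> * X k)\<^sup>2)" by simp
    also have "\<dots> = quad_form {i, j, k, l} p x"
      using dist diag unfolding power_mult_distrib sin_squared_eq
      by (simp add: quad_form_4[OF dist symp] quad_form_3[OF _ sym3] p ij kl X_def
          power2_eq_square algebra_simps)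
    finally show ?thesis .
  qed
  ultimately show ?thesis unfolding spn_on_def using symp by blast
qed

section \<open>Copositive matrices of order 4\<close>

text \<open>The entries along the path \<open>i, j, k, l\<close> are nonpositive and have angles \<open>\<alpha>\<close>, \<open>\<beta>\<close>, \<open>\<gamma>\<close> in \<open>[0, \<pi> / 2]\<close>; let
  \<open>\<delta>\<close> be the angle of \<open>a i l\<close>. If \<open>a i l \<le> 0\<close>, then either one of the four angles exceeds the sum of the
  others, and the planar Gram matrix along the other three edges lies below \<open>a\<close>, or they form a
  quadrilateral. If \<open>a i l > 0\<close>, then the planar Gram matrix lies below \<open>a\<close> unless \<open>\<alpha> + \<beta> + \<gamma>\<close> exceeds \<open>\<pi>\<close>,
  when a tridiagonal matrix does, or \<open>\<delta> < \<alpha> + \<beta> + \<gamma> \<le> \<pi>\<close>, which is again the case of a quadrilateral.\<close>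

lemma spn_on_path:
  fixes d :: "'a \<Rightarrow> real"
  assumes dist: "distinct [i, j, k, l]" and sym: "symmetric_on {i, j, k, l} a"
    and cop: "copositive_on {i, j, k, l} a"
    and diag: "\<And>v. v \<in> {i, j, k, l} \<Longrightarrow> 0 < d v \<and> a v v = (d v)\<^sup>2"
    and path: "a i j \<le> 0" "a j k \<le> 0" "a k l \<le> 0" and nonneg: "0 \<le> a i k" "0 \<le> a j l"
  shows "spn_on {i, j, k, l} a"
proof -
  let ?S = "{i, j, k, l}"
  have d': "i \<noteq> j" "i \<noteq> k" "i \<noteq> l" "j \<noteq> k" "j \<noteq> l" "k \<noteq> l" using dist by auto
  have d: "0 < d i" "0 < d j" "0 < d k" "0 < d l" using diag by auto
  have sa: "a j i = a i j" "a k i = a i k" "a l i = a i l" "a k j = a j k" "a l j = a j l" "a l k = a k l"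
    by (auto intro: symmetric_onD[OF sym])
  have pair: "\<bar>a u v\<bar> \<le> d u * d v" if "u \<in> ?S" "v \<in> ?S" "u \<noteq> v" "a u v \<le> 0" for u v
    by (rule copositive_on_offdiag_abs_le[OF _ sym cop diag that]) simp
  obtain \<alpha> where \<alpha>: "0 \<le> \<alpha>" "a i j = - (d i * d j * cos \<alpha>)" "\<alpha> \<le> pi / 2"
    using exists_angle[OF pair[of i j]] path d d' by (metis insertCI mult_pos_pos)
  obtain \<beta> where \<beta>: "0 \<le> \<beta>" "a j k = - (d j * d k * cos \<beta>)" "\<beta> \<le> pi / 2"
    using exists_angle[OF pair[of j k]] path d d' by (metis insertCI mult_pos_pos)
  obtain \<gamma> where \<gamma>: "0 \<le> \<gamma>" "a k l = - (d k * d l * cos \<gamma>)" "\<gamma> \<le> pi / 2"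
    using exists_angle[OF pair[of k l]] path d d' by (metis insertCI mult_pos_pos)
  have cos_lower: "d u * d v * cos (x + y) \<le> a u v"
    if "{c, u, v} \<subseteq> ?S" "distinct [c, u, v]" "a c u = - (d c * d u * cos x)" "0 \<le> x" "x \<le> pi / 2"
       "a c v = - (d c * d v * cos y)" "0 \<le> y" "y \<le> pi / 2" for c u v x y
    by (rule copositive_on_cos_lower[OF _ sym cop that(1,2) diag that(3-8)]) auto
  have ik: "d i * d k * cos (\<alpha> + \<beta>) \<le> a i k"
    by (rule cos_lower[of j]) (use \<alpha> \<beta> d' in \<open>auto simp: sa mult.commute\<close>)
  have jl: "d j * d l * cos (\<beta> + \<gamma>) \<le> a j l"
    by (rule cos_lower[of k]) (use \<gamma> \<beta> d' in \<open>auto simp: sa mult.commute\<close>)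
  show ?thesis
  proof (cases "a i l \<le> 0")
    case True
    obtain \<delta> where \<delta>: "0 \<le> \<delta>" "a i l = - (d i * d l * cos \<delta>)" "\<delta> \<le> pi / 2"
      using exists_angle[OF pair[of i l]] True d d' by (metis insertCI mult_pos_pos)
    have ik': "d i * d k * cos (\<delta> + \<gamma>) \<le> a i k"
      by (rule cos_lower[of l]) (use \<delta> \<gamma> d' in \<open>auto simp: sa mult.commute\<close>)
    have jl': "d j * d l * cos (\<alpha> + \<delta>) \<le> a j l"
      by (rule cos_lower[of i]) (use \<alpha> \<delta> d' in \<open>auto simp: sa mult.commute\<close>)
    have mono: "- (d u * d v * cos z) \<le> - (d u * d v * cos w)" if "u \<in> ?S" "v \<in> ?S" "0 \<le> z" "z \<le> w" "w \<le> pi / 2"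
      for u v z w
    proof -
      have "d u * d v * cos w \<le> d u * d v * cos z"
        using diag[OF that(1)] diag[OF that(2)] that(3-5) by (intro mult_left_mono cos_monotone_0_pi_le) auto
      thus ?thesis by simp
    qed
    consider "\<delta> > \<alpha> + \<beta> + \<gamma>" | "\<alpha> > \<beta> + \<gamma> + \<delta>" | "\<beta> > \<gamma> + \<delta> + \<alpha>" | "\<gamma> > \<delta> + \<alpha> + \<beta>"
      | "\<delta> \<le> \<alpha> + \<beta> + \<gamma>" "\<alpha> \<le> \<beta> + \<gamma> + \<delta>" "\<beta> \<le> \<alpha> + \<gamma> + \<delta>" "\<gamma> \<le> \<alpha> + \<beta> + \<delta>" by linarith
    thus ?thesis
    proof cases
      case 1
      show ?thesis
        by (rule spn_on_planar[OF dist sym diag \<alpha>(2) \<beta>(2) \<gamma>(2) ik jl])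
          (use 1 \<alpha> \<beta> \<gamma> \<delta> mono[of i l] in auto)
    next
      case 2
      have "spn_on {j, k, l, i} a"
      proof (rule spn_on_planar[where d = d and \<alpha> = \<beta> and \<beta> = \<gamma> and \<gamma> = \<delta>])
        show "symmetric_on {j, k, l, i} a" using sym by (simp add: insert_commute)
        show "- (d j * d i * cos (\<beta> + \<gamma> + \<delta>)) \<le> a j i"
          using mono[of j i "\<beta> + \<gamma> + \<delta>" \<alpha>] 2 \<alpha> \<beta> \<gamma> \<delta> by (simp add: sa mult.commute)
      qed (use dist diag \<beta> \<gamma> \<delta> jl ik' in \<open>auto simp: sa ac_simps\<close>)
      thus ?thesis by (simp add: insert_commute)
    next
      case 3
      have "spn_on {k, l, i, j} a"
      proof (rule spn_on_planar[where d = d and \<alpha> = \<gamma> and \<beta> = \<delta> and \<gamma> = \<alpha>])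
        show "symmetric_on {k, l, i, j} a" using sym by (simp add: insert_commute)
        show "- (d k * d j * cos (\<gamma> + \<delta> + \<alpha>)) \<le> a k j"
          using mono[of k j "\<gamma> + \<delta> + \<alpha>" \<beta>] 3 \<alpha> \<beta> \<gamma> \<delta> by (simp add: sa mult.commute)
      qed (use dist diag \<alpha> \<gamma> \<delta> jl' ik' in \<open>auto simp: sa ac_simps\<close>)
      thus ?thesis by (simp add: insert_commute)
    next
      case 4
      have "spn_on {l, i, j, k} a"
      proof (rule spn_on_planar[where d = d and \<alpha> = \<delta> and \<beta> = \<alpha> and \<gamma> = \<beta>])
        show "symmetric_on {l, i, j, k} a" using sym by (simp add: insert_commute)
        show "- (d l * d k * cos (\<delta> + \<alpha> + \<beta>)) \<le> a l k"
          using mono[of l k "\<delta> + \<alpha> + \<beta>" \<gamma>] 4 \<alpha> \<beta> \<gamma> \<delta> by (simp add: sa mult.commute)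
      qed (use dist diag \<alpha> \<beta> \<delta> jl' ik in \<open>auto simp: sa ac_simps\<close>)
      thus ?thesis by (simp add: insert_commute)
    next
      case 5
      show ?thesis
        by (rule spn_on_polygon[OF dist sym cop diag \<alpha>(2) \<beta>(2) \<gamma>(2) \<delta>(2) jl' jl])
          (use 5 \<alpha> \<beta> \<gamma> \<delta> in auto)
    qed
  next
    case False
    consider "pi < \<alpha> + \<beta> + \<gamma>" | "\<alpha> + \<beta> + \<gamma> \<le> pi" "- (d i * d l * cos (\<alpha> + \<beta> + \<gamma>)) \<le> a i l"
      | "\<alpha> + \<beta> + \<gamma> \<le> pi" "a i l < - (d i * d l * cos (\<alpha> + \<beta> + \<gamma>))" by linarith
    thus ?thesis
    proof cases
      case 1
      have "cos \<beta> \<le> cos (pi - (\<alpha> + \<gamma>))" using 1 \<alpha> \<beta> \<gamma> by (intro cos_monotone_0_pi_le) auto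
      moreover have "0 \<le> cos \<alpha> * cos \<gamma>" using \<alpha> \<gamma> by (intro mult_nonneg_nonneg cos_ge_zero) auto
      moreover have "0 \<le> cos \<beta>" using \<beta> by (intro cos_ge_zero) auto
      ultimately have "\<bar>cos \<beta>\<bar> \<le> sin \<alpha> * sin \<gamma>" by (simp add: cos_diff cos_add)
      thus ?thesis
        by (intro spn_on_tridiagonal[OF dist sym diag \<alpha>(2) \<gamma>(2), of "cos \<beta>"]) (use \<beta> False nonneg in auto)
    next
      case 2
      thus ?thesis by (intro spn_on_planar[OF dist sym diag \<alpha>(2) \<beta>(2) \<gamma>(2) ik jl])
    next
      case 3
      \<comment> \<open>An arbitrary nonnegative entry \<open>a i l\<close> need not have an angle, but this one is small enough.\<close>
      have "- (d i * d l * cos (\<alpha> + \<beta> + \<gamma>)) \<le> d i * d l"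
        using mult_left_mono[OF cos_ge_minus_one[of "\<alpha> + \<beta> + \<gamma>"], of "d i * d l"] d by simp
      hence "\<bar>a i l\<bar> \<le> d i * d l" using 3 False by linarith
      then obtain \<delta> where \<delta>: "0 \<le> \<delta>" "\<delta> \<le> pi" "a i l = - (d i * d l * cos \<delta>)" "pi / 2 \<le> \<delta>"
        using exists_angle[of "a i l" "d i * d l"] False d by (metis linear mult_pos_pos)
      have "cos (\<alpha> + \<beta> + \<gamma>) < cos \<delta>" using 3(2) d unfolding \<delta>(3) by simp
      hence "\<delta> < \<alpha> + \<beta> + \<gamma>" using 3(1) \<alpha> \<beta> \<gamma> \<delta> by (subst (asm) cos_mono_less_eq) auto
      moreover have "cos (\<alpha> + \<delta>) \<le> 0"
      proof -
        have "0 \<le> cos (\<alpha> + \<delta> - pi)" using \<alpha> \<delta> by (intro cos_ge_zero) auto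
        thus ?thesis by simp
      qed
      hence "d j * d l * cos (\<alpha> + \<delta>) \<le> a j l"
        using nonneg(2) d mult_nonneg_nonpos[of "d j * d l" "cos (\<alpha> + \<delta>)"] by simp
      ultimately show ?thesis
        by (intro spn_on_polygon[OF dist sym cop diag \<alpha>(2) \<beta>(2) \<gamma>(2) \<delta>(3) _ jl])
          (use 3(1) \<alpha> \<beta> \<gamma> \<delta> in auto)
    qed
  qed
qed

text \<open>The perfect matching \<open>ij\<close>, \<open>kl\<close> carries nonpositive entries and the matching \<open>ik\<close>, \<open>jl\<close> nonnegative ones.
  If an entry of the third matching is nonpositive, the nonpositive entries contain a path; if both are
  nonnegative, the two diagonal blocks \<open>ij\<close> and \<open>kl\<close> suffice.\<close>

lemma spn_on_matchings:
  assumes dist: "distinct [i, j, k, l]" and sym: "symmetric_on {i, j, k, l} a"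
    and cop: "copositive_on {i, j, k, l} a" and pos: "\<And>v. v \<in> {i, j, k, l} \<Longrightarrow> 0 < a v v"
    and "a i j \<le> 0" "a k l \<le> 0" "0 \<le> a i k" "0 \<le> a j l"
  shows "spn_on {i, j, k, l} a"
proof -
  define d where "d v = sqrt (a v v)" for v
  have diag: "0 < d v \<and> a v v = (d v)\<^sup>2" if "v \<in> {i, j, k, l}" for v
    using pos[OF that] by (simp add: d_def)
  have sa: "a j i = a i j" "a k i = a i k" "a l i = a i l" "a k j = a j k" "a l j = a j l" "a l k = a k l"
    by (auto intro: symmetric_onD[OF sym])
  consider "a j k \<le> 0" | "a i l \<le> 0" | "0 \<le> a j k" "0 \<le> a i l" by linarith
  thus ?thesis
  proof cases
    case 1
    thus ?thesis using assms by (intro spn_on_path[OF dist sym cop diag]) auto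
  next
    case 2
    have "spn_on {j, i, l, k} a"
    proof (rule spn_on_path[where d = d])
      show "symmetric_on {j, i, l, k} a" "copositive_on {j, i, l, k} a"
        using sym cop by (simp_all add: insert_commute)
    qed (use 2 assms diag in \<open>auto simp: sa\<close>)
    thus ?thesis by (simp add: insert_commute)
  next
    case 3
    have pair: "\<bar>a u v\<bar> \<le> d u * d v" if "u \<in> {i, j, k, l}" "v \<in> {i, j, k, l}" "u \<noteq> v" "a u v \<le> 0" for u v
      by (rule copositive_on_offdiag_abs_le[OF _ sym cop diag that]) simp
    have d: "0 < d i" "0 < d j" "0 < d k" "0 < d l" using diag by auto
    obtain \<alpha> where \<alpha>: "0 \<le> \<alpha>" "a i j = - (d i * d j * cos \<alpha>)" "\<alpha> \<le> pi"
      using exists_angle[OF pair[of i j]] assms(5) d dist by (metis distinct_length_2_or_more insertCI mult_pos_pos)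
    obtain \<gamma> where \<gamma>: "0 \<le> \<gamma>" "a k l = - (d k * d l * cos \<gamma>)" "\<gamma> \<le> pi"
      using exists_angle[OF pair[of k l]] assms(6) d dist by (metis distinct_length_2_or_more insertCI mult_pos_pos)
    show ?thesis
      by (rule spn_on_tridiagonal[OF dist sym diag \<alpha>(2) \<gamma>(2), of 0])
        (use 3 assms \<alpha> \<gamma> in \<open>auto intro!: mult_nonneg_nonneg sin_ge_zero\<close>)
  qed
qed

text \<open>Diananda's theorem in order 4. If every row has mixed signs, then of the three perfect matchings of
  the four indices one has only negative entries and another has only nonnegative entries.\<close>

lemma spn_on_card_4:
  assumes "finite S" "card S = 4" "symmetric_on S a" "copositive_on S a"
  shows "spn_on S a"
proof (cases "\<exists>k\<in>S. (\<forall>j\<in>S - {k}. 0 \<le> a k j) \<or> (\<forall>j\<in>S - {k}. a k j \<le> 0)")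
  case True
  then obtain k where k: "k \<in> S" "(\<forall>j\<in>S - {k}. 0 \<le> a k j) \<or> (\<forall>j\<in>S - {k}. a k j \<le> 0)" by blast
  show ?thesis
    by (rule spn_on_same_sign_row[OF assms(1,3,4) k], rule spn_on_card_le_3)
      (use assms(1,2) k(1) in auto)
next
  case False
  obtain i T where T: "S = insert i T" "i \<notin> T" "card T = 3" "finite T"
    using assms(1,2) card_eq_SucD[of S 3] by (auto simp: numeral_eq_Suc)
  obtain j k l where jkl: "T = {j, k, l}" "j \<noteq> k" "k \<noteq> l" "j \<noteq> l" using T(3) by (auto simp: card_3_iff)
  have S: "S = {i, j, k, l}" using T jkl by auto
  have d': "i \<noteq> j" "i \<noteq> k" "i \<noteq> l" using T jkl by auto
  have sa: "a j i = a i j" "a k i = a i k" "a l i = a i l" "a k j = a j k" "a l j = a j l" "a l k = a k l"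
    using S by (auto intro: symmetric_onD[OF assms(3)])
  have pos: "0 < a v v" if "v \<in> S" for v
  proof -
    have "a v v \<noteq> 0" using False copositive_on_offdiag_nonneg[OF assms(1,3,4) that] that by blast
    thus ?thesis using copositive_on_diag_nonneg[OF assms(1,4) that] by simp
  qed
  have match: "spn_on S a"
    if "a w x < 0" "a y z < 0" "\<not> a w y < 0" "\<not> a x z < 0" "distinct [w, x, y, z]" "{w, x, y, z} = S"
    for w x y z
    using spn_on_matchings[OF that(5), of a] that(1-4) assms(3,4) pos unfolding that(6) by auto
  have mixed: "\<exists>w\<in>S - {v}. a v w < 0" "\<exists>w\<in>S - {v}. \<not> a v w < 0" if "v \<in> S" for v
    using False that by (meson less_imp_le not_le)+
  have rest: "S - {i} = {j, k, l}" "S - {j} = {i, k, l}" "S - {k} = {i, j, l}" "S - {l} = {i, j, k}"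
    using S d' jkl by auto
  have m: "a i j < 0 \<or> a i k < 0 \<or> a i l < 0" "\<not> a i j < 0 \<or> \<not> a i k < 0 \<or> \<not> a i l < 0"
    "a i j < 0 \<or> a j k < 0 \<or> a j l < 0" "\<not> a i j < 0 \<or> \<not> a j k < 0 \<or> \<not> a j l < 0"
    "a i k < 0 \<or> a j k < 0 \<or> a k l < 0" "\<not> a i k < 0 \<or> \<not> a j k < 0 \<or> \<not> a k l < 0"
    "a i l < 0 \<or> a j l < 0 \<or> a k l < 0" "\<not> a i l < 0 \<or> \<not> a j l < 0 \<or> \<not> a k l < 0"
    using mixed[of i] mixed[of j] mixed[of k] mixed[of l] unfolding rest unfolding S by (auto simp: sa)
  consider "a i j < 0" "a k l < 0" "\<not> a i k < 0" "\<not> a j l < 0"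
    | "a i j < 0" "a k l < 0" "\<not> a i l < 0" "\<not> a j k < 0"
    | "a i k < 0" "a j l < 0" "\<not> a i j < 0" "\<not> a k l < 0"
    | "a i k < 0" "a j l < 0" "\<not> a i l < 0" "\<not> a j k < 0"
    | "a i l < 0" "a j k < 0" "\<not> a i j < 0" "\<not> a k l < 0"
    | "a i l < 0" "a j k < 0" "\<not> a i k < 0" "\<not> a j l < 0"
    using m by blast
  thus ?thesis
  proof cases
    case 1 thus ?thesis using match[of i j k l] d' jkl by (auto simp: sa S)
  next
    case 2 thus ?thesis using match[of i j l k] d' jkl by (auto simp: sa S)
  next
    case 3 thus ?thesis using match[of i k j l] d' jkl by (auto simp: sa S)
  next
    case 4 thus ?thesis using match[of i k l j] d' jkl by (auto simp: sa S)
  next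
    case 5 thus ?thesis using match[of i l j k] d' jkl by (auto simp: sa S)
  next
    case 6 thus ?thesis using match[of i l k j] d' jkl by (auto simp: sa S)
  qed
qed

section \<open>Matrices and the induction on the order\<close>

lemma quad_form_reindex:
  assumes "bij_betw f S T"
  shows "quad_form T a x = quad_form S (\<lambda>i j. a (f i) (f j)) (x \<circ> f)"
  unfolding quad_form_def sum.reindex_bij_betw[OF assms, symmetric] by simp

lemma copositive_on_reindex:
  assumes "bij_betw f S T" "copositive_on T a"
  shows "copositive_on S (\<lambda>i j. a (f i) (f j))"
  unfolding copositive_on_def
proof (intro allI impI)
  fix x :: "'a \<Rightarrow> real" assume x: "\<forall>i\<in>S. 0 \<le> x i"
  let ?y = "x \<circ> the_inv_into S f"
  have inv: "the_inv_into S f (f i) = i" if "i \<in> S" for i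
    using assms(1) that by (simp add: bij_betw_def the_inv_into_f_f)
  have "0 \<le> quad_form T a ?y"
    using assms(1) x inv by (intro copositive_onD[OF assms(2)]) (auto simp: bij_betw_def)
  also have "\<dots> = quad_form S (\<lambda>i j. a (f i) (f j)) x"
    unfolding quad_form_reindex[OF assms(1)] by (rule quad_form_cong) (auto simp: inv)
  finally show "0 \<le> quad_form S (\<lambda>i j. a (f i) (f j)) x" .
qed

lemma spn_on_reindex:
  assumes "bij_betw f S T" "spn_on S (\<lambda>i j. a (f i) (f j))"
  shows "spn_on T a"
proof -
  obtain p where p: "symmetric_on S p" "\<forall>i\<in>S. \<forall>j\<in>S. p i j \<le> a (f i) (f j)" "\<And>x. 0 \<le> quad_form S p x"
    using assms(2) by (auto simp: spn_on_def)
  let ?g = "the_inv_into S f"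
  have inv: "?g (f i) = i" if "i \<in> S" for i
    using assms(1) that by (simp add: bij_betw_def the_inv_into_f_f)
  have T: "T = f ` S" using assms(1) by (simp add: bij_betw_def)
  have "quad_form T (\<lambda>u v. p (?g u) (?g v)) x = quad_form S p (x \<circ> f)" for x
    unfolding quad_form_reindex[OF assms(1)] by (rule quad_form_cong) (auto simp: inv)
  thus ?thesis
    unfolding spn_on_def using p
    by (intro exI[of _ "\<lambda>u v. p (?g u) (?g v)"]) (auto simp: T inv symmetric_on_def)
qed

text \<open>The matrix as a function of its indices; for an \<open>n \<times> n\<close> matrix the index set is \<open>{..<n}\<close>.\<close>

definition entry :: "'a mat \<Rightarrow> nat \<Rightarrow> nat \<Rightarrow> 'a" where
  "entry A i j = A $$ (i, j)"

lemma bij_betw_insert_index: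
  assumes "i < n"
  shows "bij_betw (insert_index i) {..<n - 1} ({..<n} - {i})"
  using assms insert_index_image[of i "n - 1"] insert_index_inj_on[of i]
  by (auto simp: bij_betw_def atLeast0LessThan)

lemma symmetric_on_entry: "A \<in> sym_mats n \<Longrightarrow> symmetric_on {..<n} (entry A)"
  by (auto simp: sym_mats_def symmetric_on_def entry_def) (metis carrier_matD index_transpose_mat(1))

lemma scalar_prod_mult_mat_vec:
  assumes "A \<in> carrier_mat n n" "x \<in> carrier_vec n"
  shows "x \<bullet> (A *\<^sub>v x) = quad_form {..<n} (entry A) (\<lambda>i. x $ i)"
proof -
  have "x \<bullet> (A *\<^sub>v x) = (\<Sum>i\<in>{0..<n}. x $ i * (\<Sum>j\<in>{0..<n}. A $$ (i, j) * x $ j))"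
    using assms by (auto simp: scalar_prod_def intro!: sum.cong)
  thus ?thesis
    by (simp add: quad_form_def entry_def sum_distrib_left atLeast0LessThan mult_ac)
qed

lemma copositive_on_entry:
  assumes "A \<in> sym_mats n" "copositive A"
  shows "copositive_on {..<n} (entry A)"
  unfolding copositive_on_def
proof (intro allI impI)
  fix x :: "nat \<Rightarrow> real" assume x: "\<forall>i\<in>{..<n}. 0 \<le> x i"
  have A: "A \<in> carrier_mat n n" "dim_row A = n" using assms(1) by (auto simp: sym_mats_def)
  have "0\<^sub>v n \<le> vec n x" using x by (auto simp: less_eq_vec_def)
  hence "0 \<le> vec n x \<bullet> (A *\<^sub>v vec n x)" using assms(2) A unfolding copositive_def by auto
  also have "\<dots> = quad_form {..<n} (entry A) (\<lambda>i. vec n x $ i)"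
    using A by (intro scalar_prod_mult_mat_vec) auto
  also have "\<dots> = quad_form {..<n} (entry A) x" by (rule quad_form_cong) auto
  finally show "0 \<le> quad_form {..<n} (entry A) x" .
qed

lemma has_spn_decomposition_entry:
  assumes "A \<in> sym_mats n" "spn_on {..<n} (entry A)"
  shows "has_spn_decomposition A"
proof -
  have A: "A \<in> carrier_mat n n" using assms(1) by (auto simp: sym_mats_def)
  obtain p where p: "symmetric_on {..<n} p" "\<forall>i\<in>{..<n}. \<forall>j\<in>{..<n}. p i j \<le> entry A i j"
    "\<And>x. 0 \<le> quad_form {..<n} p x"
    using assms(2) by (auto simp: spn_on_def)
  define P where "P = mat n n (\<lambda>(i, j). p i j)"
  define N where "N = mat n n (\<lambda>(i, j). entry A i j - p i j)"
  have sp: "p i j = p j i" "entry A i j = entry A j i" if "i < n" "j < n" for i j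
    using symmetric_onD[OF p(1), of i j] symmetric_onD[OF symmetric_on_entry[OF assms(1)], of i j] that by auto
  have P: "P \<in> sym_mats n" and N: "N \<in> sym_mats n"
    using sp by (auto simp: sym_mats_def P_def N_def)
  have "A = P + N" using A by (intro eq_matI) (auto simp: P_def N_def entry_def)
  moreover have "pos_semidef P"
  proof -
    have "0 \<le> x \<bullet> (P *\<^sub>v x)" if x: "x \<in> carrier_vec n" for x
    proof -
      have "x \<bullet> (P *\<^sub>v x) = quad_form {..<n} (entry P) (\<lambda>i. x $ i)"
        using P x by (intro scalar_prod_mult_mat_vec) (auto simp: sym_mats_def)
      also have "\<dots> = quad_form {..<n} p (\<lambda>i. x $ i)"
        by (rule quad_form_cong) (auto simp: entry_def P_def)
      finally show ?thesis using p(3) by simp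
    qed
    thus ?thesis using P by (auto simp: pos_semidef_def sym_mats_def)
  qed
  moreover have "0\<^sub>m n n \<le> N" using p(2) by (auto simp: less_eq_mat_def N_def)
  ultimately show ?thesis
    unfolding has_spn_decomposition_def carrier_matD(1)[OF A] using P N by blast
qed

lemma entry_mat_delete:
  assumes "A \<in> carrier_mat n n" "i < n" "u < n - 1" "v < n - 1"
  shows "entry (mat_delete A i i) u v = entry A (insert_index i u) (insert_index i v)"
  using mat_delete_index[of A "n - 1" i i u v] assms by (simp add: entry_def)

lemma entry_schur_complement:
  assumes "A \<in> sym_mats n" "i < n" "u < n - 1" "v < n - 1"
  shows "entry (schur_complement A i) u v = schur_on i (entry A) (insert_index i u) (insert_index i v)"
proof -
  have A: "A \<in> carrier_mat n n" using assms(1) by (auto simp: sym_mats_def)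
  have "insert_index i v < n" using assms(2,4) by (auto simp: insert_index_def)
  hence "A $$ (insert_index i v, i) = A $$ (i, insert_index i v)"
    using symmetric_onD[OF symmetric_on_entry[OF assms(1)], of "insert_index i v" i] assms(2)
    by (simp add: entry_def)
  thus ?thesis
    using entry_mat_delete[OF A assms(2-4)] A assms(2-4)
    by (simp add: entry_def schur_complement_def schur_on_def outer_prod_def col_delete_def)
qed

lemma copositive_on_cong:
  "\<lbrakk>copositive_on S a; \<And>i j. i \<in> S \<Longrightarrow> j \<in> S \<Longrightarrow> a i j = b i j\<rbrakk> \<Longrightarrow> copositive_on S b"
  unfolding copositive_on_def using quad_form_cong[of S a b] by simp

text \<open>The induction on the order. From order 5 on, the two reductions lead to a member of the class of the
  next smaller order; the base is the general theorem for orders at most 4.\<close>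

lemma spn_on_of_reduction_class:
  fixes \<A> :: "nat \<Rightarrow> real mat set"
  assumes sym: "\<And>n. n \<ge> 1 \<Longrightarrow> \<A> n \<subseteq> sym_mats n"
    and delete: "\<And>n A i. n \<ge> 5 \<Longrightarrow> A \<in> \<A> n \<Longrightarrow> i < n \<Longrightarrow> offdiag_nonneg A i \<Longrightarrow>
           mat_delete A i i \<in> \<A> (n - 1)"
    and schur: "\<And>n A. n \<ge> 5 \<Longrightarrow> A \<in> \<A> n \<Longrightarrow> \<not> (\<exists>i<n. \<forall>j<n. 0 \<le> A $$ (i, j)) \<Longrightarrow>
           \<exists>i<n. offdiag_nonpos A i \<and> A $$ (i, i) \<noteq> 0 \<and> schur_complement A i \<in> \<A> (n - 1)"
    and "n \<ge> 1" "A \<in> \<A> n" "copositive_on {..<n} (entry A)"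
  shows "spn_on {..<n} (entry A)"
  using assms(4-6)
proof (induction n arbitrary: A rule: less_induct)
  case (less n)
  have symA: "A \<in> sym_mats n" using sym less.prems by blast
  hence A: "A \<in> carrier_mat n n" by (auto simp: sym_mats_def)
  note sy = symmetric_on_entry[OF symA]
  show ?case
  proof (cases "n \<ge> 5")
    case False
    hence "n \<le> 3 \<or> n = 4" by linarith
    thus ?thesis
      using spn_on_card_le_3[of "{..<n}", OF _ _ sy less.prems(3)]
        spn_on_card_4[of "{..<n}", OF _ _ sy less.prems(3)] by auto
  next
    case n: True
    \<comment> \<open>The induction hypothesis, for a matrix \<open>B\<close> that renumbers a function \<open>c\<close> on \<open>{..<n} - {i}\<close>.\<close>
    have IH: "spn_on ({..<n} - {i}) c"
      if "i < n" "copositive_on ({..<n} - {i}) c" "B \<in> \<A> (n - 1)"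
        "\<And>u v. u < n - 1 \<Longrightarrow> v < n - 1 \<Longrightarrow> entry B u v = c (insert_index i u) (insert_index i v)"
      for i B c
    proof -
      note bij = bij_betw_insert_index[OF that(1)]
      have "copositive_on {..<n - 1} (entry B)"
        by (rule copositive_on_cong[OF copositive_on_reindex[OF bij that(2)]])
          (use that(4) in auto)
      hence "spn_on {..<n - 1} (entry B)" using n that(3) by (intro less.IH) auto
      hence "spn_on {..<n - 1} (\<lambda>u v. c (insert_index i u) (insert_index i v))"
        by (rule spn_on_mono) (use that(4) in auto)
      thus ?thesis by (rule spn_on_reindex[OF bij])
    qed
    show ?thesis
    proof (cases "\<exists>i<n. offdiag_nonneg A i")
      case True
      then obtain i where i: "i < n" "offdiag_nonneg A i" by blast
      have "spn_on ({..<n} - {i}) (entry A)"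
        by (rule IH[OF i(1) _ delete[OF n less.prems(2) i] entry_mat_delete[OF A i(1)]])
          (rule copositive_on_subset[OF _ less.prems(3)], auto)
      thus ?thesis
        using i A by (intro spn_on_nonneg_row[OF _ sy less.prems(3), of i])
          (auto simp: offdiag_nonneg_def entry_def[of A i])
    next
      case False
      hence "\<not> (\<exists>i<n. \<forall>j<n. 0 \<le> A $$ (i, j))" using A by (auto simp: offdiag_nonneg_def)
      then obtain i where i: "i < n" "offdiag_nonpos A i" "A $$ (i, i) \<noteq> 0"
        "schur_complement A i \<in> \<A> (n - 1)"
        using schur[OF n less.prems(2)] by blast
      have pos: "0 < entry A i i"
        using copositive_on_diag_nonneg[OF _ less.prems(3), of i] i by (simp add: entry_def)
      have "copositive_on ({..<n} - {i}) (schur_on i (entry A))"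
        using i A by (intro copositive_on_schur[OF _ sy less.prems(3) _ pos])
          (auto simp: offdiag_nonpos_def entry_def[of A i])
      hence "spn_on ({..<n} - {i}) (schur_on i (entry A))"
        by (rule IH[OF i(1) _ i(4) entry_schur_complement[OF symA i(1)]])
      thus ?thesis using i by (intro spn_on_schur[of _ _ i, OF _ sy _ pos]) auto
    qed
  qed
qed

theorem theorem3p1:
  fixes \<A> :: "nat \<Rightarrow> real mat set"
  assumes "\<And>n. n \<ge> 1 \<Longrightarrow> \<A> n \<subseteq> sym_mats n"
    and "\<And>n A. n \<ge> 5 \<Longrightarrow> A \<in> \<A> n \<Longrightarrow>
           \<exists>i<n. offdiag_nonneg A i \<or>
                 (offdiag_nonpos A i \<and> (\<exists>j<n. j \<noteq> i \<and> A $$ (i, j) \<noteq> 0))"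
    and "\<And>n A i. n \<ge> 5 \<Longrightarrow> A \<in> \<A> n \<Longrightarrow> i < n \<Longrightarrow> offdiag_nonneg A i \<Longrightarrow>
           mat_delete A i i \<in> \<A> (n - 1)"
    and "\<And>n A. n \<ge> 5 \<Longrightarrow> A \<in> \<A> n \<Longrightarrow> \<not> (\<exists>i<n. \<forall>j<n. 0 \<le> A $$ (i, j)) \<Longrightarrow>
           \<exists>i<n. offdiag_nonpos A i \<and> A $$ (i, i) \<noteq> 0 \<and> schur_complement A i \<in> \<A> (n - 1)"
    and "A \<in> (\<Union>n\<in>{1..}. \<A> n)"
    and "copositive A"
  shows "has_spn_decomposition A"
proof -
  obtain n where n: "n \<ge> 1" "A \<in> \<A> n" using assms(5) by auto
  have sym: "A \<in> sym_mats n" using assms(1) n by blast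
  have "spn_on {..<n} (entry A)"
    by (rule spn_on_of_reduction_class[OF assms(1,3,4) n copositive_on_entry[OF sym assms(6)]])
  thus ?thesis by (rule has_spn_decomposition_entry[OF sym])
qed

end
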